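(* Assume the standing setup with $\int_0^T\sigma(s)^2\,\mathrm{d} s<\infty$ and \[ b(t)=\frac{\sigma(t)^2}{-2K\int_t^T\sigma(s)^2\,\mathrm{d} s},\qquad t\in[0,T), \] for some $K\neq0$. Then for every $\alpha\in\mathbb{R}$, the maximum likelihood estimator is strongly consistent: $\mathsf{P}\left(\lim_{t\uparrow T}\widehat\alpha_t=\alpha\right)=1$.
   Context: Standing setup: $T\in(0,\infty]$; $b:[0,T)\to\mathbb{R}\setminus\{0\}$ and $\sigma:[0,T)\to(0,\infty)$ are continuously differentiable; $(B_t)_{t\in[0,T)}$ is a standard Wiener process. For $\alpha\in\mathbb{R}$, $(X^{(\alpha)}_t)_{t\in[0,T)}$ is the unique strong solution of $\mathrm{d} X^{(\alpha)}_t=\alpha b(t)X^{(\alpha)}_t\,\mathrm{d} t+\sigma(t)\,\mathrm{d} B_t$, $X^{(\alpha)}_0=0$. The maximum likelihood estimator of $\alpha$ based on $(X^{(\alpha)}_s)_{s\in[0,t]}$ is (almost surely well defined) $\widehat\alpha_t:=\dfrac{\int_0^t\frac{b(s)}{\sigma(s)^2}X^{(\alpha)}_s\,\mathrm{d} X^{(\alpha)}_s}{\int_0^t\frac{b(s)^2}{\sigma(s)^2}(X^{(\alpha)}_s)^2\,\mathrm{d} s}$, $t\in(0,T)$. *)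

theory Defs
  imports "HOL-Probability.Probability"
begin

definition time_dom :: "ereal \<Rightarrow> real set" where
  "time_dom T = {t. 0 \<le> t \<and> ereal t < T}"

definition time_limit :: "ereal \<Rightarrow> real filter" where
  "time_limit T = (if T = \<infinity> then at_top else at_left (real_of_ereal T))"

definition C1_on :: "real set \<Rightarrow> (real \<Rightarrow> real) \<Rightarrow> bool" where
  "C1_on S f \<longleftrightarrow> (\<exists>f'. continuous_on S f' \<and>
      (\<forall>t\<in>S. (f has_real_derivative f' t) (at t within S)))"

definition wiener_process :: "'a measure \<Rightarrow> ereal \<Rightarrow> (real \<Rightarrow> 'a \<Rightarrow> real) \<Rightarrow> bool" where
  "wiener_process M T B \<longleftrightarrow>
     prob_space M \<and>
     (\<forall>t\<in>time_dom T. B t \<in> borel_measurable M) \<and>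
     (\<forall>\<omega>\<in>space M. B 0 \<omega> = 0 \<and> continuous_on (time_dom T) (\<lambda>t. B t \<omega>)) \<and>
     (\<forall>ts :: real list. ts \<noteq> [] \<and> sorted_wrt (<) ts \<and> set ts \<subseteq> time_dom T \<longrightarrow>
        prob_space.indep_vars M (\<lambda>_. borel) (\<lambda>i \<omega>. B (ts ! Suc i) \<omega> - B (ts ! i) \<omega>)
          {..<length ts - 1}) \<and>
     (\<forall>s t. s \<in> time_dom T \<and> t \<in> time_dom T \<and> s < t \<longrightarrow>
        distributed M lborel (\<lambda>\<omega>. B t \<omega> - B s \<omega>)
          (\<lambda>x. ennreal (normal_density 0 (sqrt (t - s)) x)))"

definition riemann_sum :: "(real \<Rightarrow> 'a \<Rightarrow> real) \<Rightarrow> (real \<Rightarrow> 'a \<Rightarrow> real) \<Rightarrow> real \<Rightarrow> nat \<Rightarrow> 'a \<Rightarrow> real" where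
  "riemann_sum H Y t n \<omega> =
     (\<Sum>k<n. H (real k * t / real n) \<omega> * (Y (real (Suc k) * t / real n) \<omega> - Y (real k * t / real n) \<omega>))"

definition conv_in_prob :: "'a measure \<Rightarrow> (nat \<Rightarrow> 'a \<Rightarrow> real) \<Rightarrow> ('a \<Rightarrow> real) \<Rightarrow> bool" where
  "conv_in_prob M Z I \<longleftrightarrow> (\<forall>n. Z n \<in> borel_measurable M) \<and> I \<in> borel_measurable M \<and>
     (\<forall>\<epsilon>>0. (\<lambda>n. measure M {\<omega>\<in>space M. \<epsilon> < \<bar>Z n \<omega> - I \<omega>\<bar>}) \<longlonglongrightarrow> 0)"

text \<open>I is (a version of) the Ito integral of the continuous adapted integrand H against
  the continuous semimartingale Y over [0,t]: limit in probability of left Riemann sums.\<close>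
definition stoch_integral :: "'a measure \<Rightarrow> (real \<Rightarrow> 'a \<Rightarrow> real) \<Rightarrow> (real \<Rightarrow> 'a \<Rightarrow> real) \<Rightarrow> real \<Rightarrow> ('a \<Rightarrow> real) \<Rightarrow> bool" where
  "stoch_integral M H Y t I \<longleftrightarrow> conv_in_prob M (riemann_sum H Y t) I"

definition strong_solution :: "'a measure \<Rightarrow> ereal \<Rightarrow> real \<Rightarrow> (real \<Rightarrow> real) \<Rightarrow> (real \<Rightarrow> real)
    \<Rightarrow> (real \<Rightarrow> 'a \<Rightarrow> real) \<Rightarrow> (real \<Rightarrow> 'a \<Rightarrow> real) \<Rightarrow> bool" where
  "strong_solution M T \<alpha> b \<sigma> B X \<longleftrightarrow>
     (\<forall>t\<in>time_dom T. X t \<in> borel_measurable M) \<and>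
     (\<forall>\<omega>\<in>space M. X 0 \<omega> = 0 \<and> continuous_on (time_dom T) (\<lambda>t. X t \<omega>)) \<and>
     (\<forall>t\<in>time_dom T. \<exists>I. stoch_integral M (\<lambda>s \<omega>. \<sigma> s) B t I \<and>
        (AE \<omega> in M. X t \<omega> = integral {0..t} (\<lambda>s. \<alpha> * b s * X s \<omega>) + I \<omega>))"

end

theory Submission
  imports Defs
begin

text \<open>
  Put \<open>g = b / \<sigma>\<^sup>2\<close> and \<open>energy t = \<integral>\<^sub>0\<^sup>t (g \<sigma> X)\<^sup>2 ds\<close>, the denominator of the estimator. Since \<open>\<sigma>\<close> is C1, the
  equation for \<open>X\<close> holds pathwise, and the Riemann sums of \<open>N t - \<alpha> * energy t\<close> agree, up to a pathwise
  vanishing error, with sums \<open>\<Sum> h\<^sub>k \<Delta>B\<^sub>k\<close> whose coefficients come from the Euler scheme and hence depend only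
  on earlier grid increments. The discrete exponential martingale inequality passes to the limit, so for
  every fixed \<open>\<theta>\<close> the process \<open>\<theta> (N - \<alpha> energy) - \<theta>\<^sup>2 energy / 2\<close> is almost surely bounded above on \<open>(0, T)\<close>.
  Taking \<open>\<theta> = 1/m\<close> and \<open>\<theta> = -1/m\<close>, consistency follows as soon as the energy tends to infinity.

  For the latter, let \<open>S t = \<integral>\<^sub>t\<^sup>T \<sigma>\<^sup>2 ds\<close>. Ito's formula for \<open>X\<^sup>2 / S\<close> reads
  \<open>X\<^sup>2 / S = u + 4 K\<^sup>2 energy - 4 K N\<close> with \<open>u = ln (S 0 / S) \<rightarrow> \<infinity>\<close>. If the energy were bounded, so would be \<open>N\<close>,
  whence \<open>X\<^sup>2 / S \<ge> u - c\<close>, and \<open>4 K\<^sup>2 energy = \<integral> (X\<^sup>2 / S) du\<close> would be infinite.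
\<close>

section \<open>Calculus of grid sums\<close>

text \<open>No filtration is given: \<open>wiener_process\<close> speaks of increments of
  \<open>B\<close> over finite partitions, and \<open>strong_solution\<close> does not say that
  \<open>X\<close> is adapted. The Euler scheme restores adaptedness, because its values are
  explicit functions of earlier increments. A second obstacle is that \<open>stoch_integral\<close>
  is a limit in probability at one fixed time. So limits are taken along almost surely convergent
  subsequences, and statements about all times are first obtained at countably many times and then
  extended by continuity of paths.

  The underlying martingale is the integral of \<open>g * \<sigma> * X\<close> against
  \<open>B\<close>, with bracket \<open>energy\<close>; it equals
  \<open>N - \<alpha> * energy\<close>. Bounding the tilted processes with parameters
  \<open>\<theta>\<close> and \<open>- \<theta>\<close> by \<open>C\<close> gives \<open>|N -
  \<alpha> * energy| \<le> C / \<theta> + (\<theta> / 2) * energy\<close>, so the error of the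
  estimator drops below \<open>\<theta>\<close> once the energy is large.

  In the time scale \<open>u\<close> the process \<open>X / sqrt S\<close> has drift rate
  \<open>(1 - \<alpha> / K) / 2\<close>. Its sign separates mean reverting from explosive behaviour,
  and the argument treats all cases alike.\<close>

definition grid :: "real \<Rightarrow> nat \<Rightarrow> nat \<Rightarrow> real" where
  "grid t n k = real k * t / real n"

lemma grid_0 [simp]: "grid t n 0 = 0"
  by (simp add: grid_def)

lemma grid_end: "0 < n \<Longrightarrow> grid t n n = t"
  by (simp add: grid_def)

lemma grid_nonneg: "0 < t \<Longrightarrow> 0 \<le> grid t n k"
  by (simp add: grid_def)

lemma grid_le: "0 < t \<Longrightarrow> k \<le> n \<Longrightarrow> grid t n k \<le> t"
  by (cases "n = 0") (auto simp: grid_def field_simps)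

lemma grid_mem: "0 < t \<Longrightarrow> k \<le> n \<Longrightarrow> grid t n k \<in> {0..t}"
  by (simp add: grid_nonneg grid_le)

lemma grid_Suc_diff: "grid t n (Suc k) - grid t n k = t / real n"
  by (simp add: grid_def diff_divide_distrib[symmetric] algebra_simps)

lemma grid_mono: "0 < t \<Longrightarrow> grid t n k \<le> grid t n (Suc k)"
  using grid_Suc_diff[of t n k] by (smt (verit) divide_nonneg_nonneg of_nat_0_le_iff)

lemma grid_interval_subset:
  "0 < t \<Longrightarrow> k < n \<Longrightarrow> {grid t n k..grid t n (Suc k)} \<subseteq> {0..t}"
  using grid_nonneg[of t n k] grid_le[of t "Suc k" n] by auto

lemma grid_refine: "grid (grid t m i) (i * r) k = grid t (m * r) k" if "0 < i"
  using that by (simp add: grid_def field_simps)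

text \<open>A remainder that is \<open>o(1/n)\<close> uniformly over the grid is expressed by
  \<open>grid_null (\<lambda>n k. real n * r n k)\<close>.\<close>

definition grid_null :: "(nat \<Rightarrow> nat \<Rightarrow> real) \<Rightarrow> bool" where
  "grid_null r \<longleftrightarrow> (\<forall>\<epsilon>>0. \<forall>\<^sub>F n in sequentially. \<forall>k<n. \<bar>r n k\<bar> \<le> \<epsilon>)"

definition grid_bdd :: "(nat \<Rightarrow> nat \<Rightarrow> real) \<Rightarrow> bool" where
  "grid_bdd r \<longleftrightarrow> (\<exists>C\<ge>0. \<forall>n. \<forall>k<n. \<bar>r n k\<bar> \<le> C)"

lemma grid_nullD: "grid_null r \<Longrightarrow> 0 < \<epsilon> \<Longrightarrow> \<forall>\<^sub>F n in sequentially. \<forall>k<n. \<bar>r n k\<bar> \<le> \<epsilon>"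
  by (simp add: grid_null_def)

lemma grid_null_add:
  assumes "grid_null r" "grid_null s"
  shows "grid_null (\<lambda>n k. r n k + s n k)"
  unfolding grid_null_def
proof (intro allI impI)
  fix \<epsilon> :: real assume "0 < \<epsilon>"
  then have "0 < \<epsilon> / 2" by simp
  from grid_nullD[OF assms(1) this] grid_nullD[OF assms(2) this]
  show "\<forall>\<^sub>F n in sequentially. \<forall>k<n. \<bar>r n k + s n k\<bar> \<le> \<epsilon>"
    by eventually_elim (smt (verit) field_sum_of_halves)
qed

lemma grid_null_mult_bdd:
  assumes "grid_bdd c" "grid_null r"
  shows "grid_null (\<lambda>n k. c n k * r n k)"
  unfolding grid_null_def
proof (intro allI impI)
  fix \<epsilon> :: real assume e: "0 < \<epsilon>"
  obtain C where C: "C \<ge> 0" "\<forall>n. \<forall>k<n. \<bar>c n k\<bar> \<le> C"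
    using assms(1) by (auto simp: grid_bdd_def)
  have "0 < \<epsilon> / (C + 1)" using e C by simp
  from grid_nullD[OF assms(2) this]
  show "\<forall>\<^sub>F n in sequentially. \<forall>k<n. \<bar>c n k * r n k\<bar> \<le> \<epsilon>"
  proof eventually_elim
    case (elim n)
    show ?case
    proof (intro allI impI)
      fix k assume k: "k < n"
      have "\<bar>c n k * r n k\<bar> \<le> C * (\<epsilon> / (C + 1))"
        unfolding abs_mult using C elim k by (intro mult_mono) auto
      also have "\<dots> \<le> \<epsilon>" using C e by (simp add: field_simps)
      finally show "\<bar>c n k * r n k\<bar> \<le> \<epsilon>" .
    qed
  qed
qed

lemma grid_null_cong:
  assumes "grid_null r" "\<And>n k. k < n \<Longrightarrow> r n k = s n k"
  shows "grid_null s"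
  using assms by (simp add: grid_null_def cong: all_cong)

lemma grid_bdd_mult:
  assumes "grid_bdd r" "grid_bdd s"
  shows "grid_bdd (\<lambda>n k. r n k * s n k)"
proof -
  obtain C E where "C \<ge> 0" "\<forall>n. \<forall>k<n. \<bar>r n k\<bar> \<le> C" "E \<ge> 0" "\<forall>n. \<forall>k<n. \<bar>s n k\<bar> \<le> E"
    using assms by (auto simp: grid_bdd_def)
  then have "\<forall>n. \<forall>k<n. \<bar>r n k * s n k\<bar> \<le> C * E" "0 \<le> C * E"
    unfolding abs_mult by (auto intro!: mult_mono)
  then show ?thesis unfolding grid_bdd_def by blast
qed

lemma grid_bdd_add:
  assumes "grid_bdd r" "grid_bdd s"
  shows "grid_bdd (\<lambda>n k. r n k + s n k)"
proof -
  obtain C E where "C \<ge> 0" "\<forall>n. \<forall>k<n. \<bar>r n k\<bar> \<le> C" "E \<ge> 0" "\<forall>n. \<forall>k<n. \<bar>s n k\<bar> \<le> E"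
    using assms by (auto simp: grid_bdd_def)
  then have "\<forall>n. \<forall>k<n. \<bar>r n k + s n k\<bar> \<le> C + E" "0 \<le> C + E"
    by (auto intro!: order_trans[OF abs_triangle_ineq] add_mono)
  then show ?thesis unfolding grid_bdd_def by blast
qed

lemma grid_bdd_const: "grid_bdd (\<lambda>n k. c)"
  unfolding grid_bdd_def by (intro exI[of _ "\<bar>c\<bar>"]) auto

text \<open>There are \<open>n\<close> terms of size at most \<open>e / (2 * n)\<close>; this is why
  local errors have to be \<open>o(1/n)\<close> and not merely small.\<close>

lemma grid_null_sum:
  assumes "grid_null (\<lambda>n k. real n * r n k)"
  shows "(\<lambda>n. \<Sum>k<n. r n k) \<longlonglongrightarrow> 0"
proof (rule LIMSEQ_I)
  fix e :: real assume "0 < e"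
  then have "0 < e / 2" by simp
  from grid_nullD[OF assms this]
  have "\<forall>\<^sub>F n in sequentially. norm ((\<Sum>k<n. r n k) - 0) < e"
    using eventually_gt_at_top[of 0]
  proof eventually_elim
    case (elim n)
    have "\<bar>\<Sum>k<n. r n k\<bar> \<le> (\<Sum>k<n. \<bar>r n k\<bar>)" by (rule sum_abs)
    also have "\<dots> \<le> (\<Sum>k<n. (e / 2) / real n)"
      using elim by (intro sum_mono) (auto simp: abs_mult field_simps)
    also have "\<dots> < e" using elim \<open>0 < e\<close> by simp
    finally show ?case by simp
  qed
  then show "\<exists>no. \<forall>n\<ge>no. norm ((\<Sum>k<n. r n k) - 0) < e"
    by (simp add: eventually_sequentially)
qed

lemma grid_oscillation:
  fixes f :: "real \<Rightarrow> real"
  assumes t: "0 < t" and f: "continuous_on {0..t} f" and e: "0 < \<epsilon>"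
  shows "\<forall>\<^sub>F n in sequentially. \<forall>k<n. \<forall>s\<in>{grid t n k..grid t n (Suc k)}.
           \<forall>r\<in>{grid t n k..grid t n (Suc k)}. \<bar>f s - f r\<bar> \<le> \<epsilon>"
proof -
  have "uniformly_continuous_on {0..t} f"
    using f by (intro compact_uniformly_continuous) auto
  then obtain d where d: "d > 0"
    "\<And>x y. x \<in> {0..t} \<Longrightarrow> y \<in> {0..t} \<Longrightarrow> dist y x < d \<Longrightarrow> dist (f y) (f x) < \<epsilon>"
    using e unfolding uniformly_continuous_on_def by metis
  have "(\<lambda>n. t / real n) \<longlonglongrightarrow> 0" by (rule lim_const_over_n)
  then have "\<forall>\<^sub>F n in sequentially. t / real n < d"
    using d(1) by (rule order_tendstoD)
  then show ?thesis
  proof eventually_elim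
    case (elim n)
    show ?case
    proof (intro allI impI ballI)
      fix k s r assume k: "k < n" and s: "s \<in> {grid t n k..grid t n (Suc k)}"
        and r: "r \<in> {grid t n k..grid t n (Suc k)}"
      have "dist s r \<le> t / real n"
        using s r grid_Suc_diff[of t n k] by (auto simp: dist_real_def)
      then have "dist s r < d" using elim by simp
      then have "dist (f s) (f r) < \<epsilon>"
        using d(2) grid_interval_subset[OF t k] s r by blast
      then show "\<bar>f s - f r\<bar> \<le> \<epsilon>" by (simp add: dist_real_def)
    qed
  qed
qed

lemma grid_null_increment:
  assumes t: "0 < t" and f: "continuous_on {0..t} f"
  shows "grid_null (\<lambda>n k. f (grid t n (Suc k)) - f (grid t n k))"
  unfolding grid_null_def
proof (intro allI impI)
  fix \<epsilon> :: real assume "0 < \<epsilon>"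
  from grid_oscillation[OF t f this]
  show "\<forall>\<^sub>F n in sequentially. \<forall>k<n. \<bar>f (grid t n (Suc k)) - f (grid t n k)\<bar> \<le> \<epsilon>"
    by eventually_elim (use grid_mono[OF t] in auto)
qed

lemma grid_bdd_continuous:
  fixes f :: "real \<Rightarrow> real"
  assumes t: "0 < t" and f: "continuous_on {0..t} f"
  shows "grid_bdd (\<lambda>n k. f (grid t n k))" "grid_bdd (\<lambda>n k. f (grid t n (Suc k)))"
proof -
  have "bounded (f ` {0..t})"
    using f by (intro compact_imp_bounded compact_continuous_image) auto
  then obtain C where C: "\<forall>x\<in>{0..t}. \<bar>f x\<bar> \<le> C"
    by (auto simp: bounded_iff)
  have "0 \<le> C" using C t by (smt (verit) atLeastAtMost_iff)
  then show "grid_bdd (\<lambda>n k. f (grid t n k))" "grid_bdd (\<lambda>n k. f (grid t n (Suc k)))"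
    using C grid_mem[OF t] unfolding grid_bdd_def by (metis less_imp_le_nat, metis Suc_leI)
qed

section \<open>Local errors of Riemann and Stieltjes sums\<close>

lemma integral_deviation_bound:
  fixes f :: "real \<Rightarrow> real"
  assumes "continuous_on {u..v} f" "u \<le> v" "\<And>s. s \<in> {u..v} \<Longrightarrow> \<bar>f s\<bar> \<le> c"
  shows "\<bar>integral {u..v} f\<bar> \<le> c * (v - u)"
  using integral_bound[of u v f c] assms by simp

lemma grid_null_riemann_step:
  fixes f :: "real \<Rightarrow> real"
  assumes t: "0 < t" and f: "continuous_on {0..t} f"
  shows "grid_null (\<lambda>n k. real n *
    (integral {grid t n k..grid t n (Suc k)} f - f (grid t n k) * (t / real n)))"
  unfolding grid_null_def
proof (intro allI impI)
  fix \<epsilon> :: real assume "0 < \<epsilon>"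
  then have "0 < \<epsilon> / t" using t by simp
  from grid_oscillation[OF t f this]
  show "\<forall>\<^sub>F n in sequentially. \<forall>k<n. \<bar>real n *
    (integral {grid t n k..grid t n (Suc k)} f - f (grid t n k) * (t / real n))\<bar> \<le> \<epsilon>"
  proof eventually_elim
    case (elim n)
    show ?case
    proof (intro allI impI)
      fix k assume k: "k < n"
      let ?I = "{grid t n k..grid t n (Suc k)}"
      have c: "continuous_on ?I f"
        using f grid_interval_subset[OF t k] continuous_on_subset by blast
      have "integral ?I (\<lambda>s. f s - f (grid t n k)) = integral ?I f - f (grid t n k) * (t / real n)"
        using c grid_mono[OF t, of n k] grid_Suc_diff[of t n k]
        by (subst integral_diff) (auto intro: integrable_continuous_real)
      moreover have "\<bar>integral ?I (\<lambda>s. f s - f (grid t n k))\<bar> \<le> \<epsilon> / t * (grid t n (Suc k) - grid t n k)"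
        using c grid_mono[OF t, of n k] elim k
        by (intro integral_deviation_bound continuous_intros) auto
      ultimately have "\<bar>integral ?I f - f (grid t n k) * (t / real n)\<bar> \<le> \<epsilon> / real n"
        using t by (simp add: grid_Suc_diff)
      then show "\<bar>real n * (integral ?I f - f (grid t n k) * (t / real n))\<bar> \<le> \<epsilon>"
        using k unfolding abs_mult by (simp add: field_simps)
    qed
  qed
qed

lemma sum_integral_grid:
  fixes f :: "real \<Rightarrow> real"
  assumes t: "0 < t" and f: "continuous_on {0..t} f" and m: "m \<le> n"
  shows "(\<Sum>k<m. integral {grid t n k..grid t n (Suc k)} f) = integral {0..grid t n m} f"
  using m
proof (induction m)
  case (Suc m)
  have "integral {0..grid t n m} f + integral {grid t n m..grid t n (Suc m)} f
      = integral {0..grid t n (Suc m)} f"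
    using Suc.prems t f grid_le[OF t Suc.prems]
    by (intro Henstock_Kurzweil_Integration.integral_combine grid_nonneg grid_mono
        integrable_continuous_real continuous_on_subset[OF f]) auto
  then show ?case using Suc by simp
qed simp

lemma riemann_sum_tendsto_integral:
  fixes f :: "real \<Rightarrow> real"
  assumes t: "0 < t" and f: "continuous_on {0..t} f"
  shows "(\<lambda>n. \<Sum>k<n. f (grid t n k) * (t / real n)) \<longlonglongrightarrow> integral {0..t} f"
proof -
  have "(\<lambda>n. integral {0..t} f - (\<Sum>k<n. integral {grid t n k..grid t n (Suc k)} f - f (grid t n k) * (t / real n)))
     \<longlonglongrightarrow> integral {0..t} f - 0"
    by (intro tendsto_intros grid_null_sum grid_null_riemann_step t f)
  moreover have "\<forall>\<^sub>F n in sequentially. integral {0..t} f - (\<Sum>k<n. integral {grid t n k..grid t n (Suc k)} f - f (grid t n k) * (t / real n))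
     = (\<Sum>k<n. f (grid t n k) * (t / real n))"
    using eventually_gt_at_top[of 0]
  proof eventually_elim
    case (elim n)
    show ?case
      using sum_integral_grid[OF t f order_refl, of n] grid_end[OF elim, of t]
      by (simp add: sum_subtractf)
  qed
  ultimately show ?thesis
    by (auto intro: Lim_transform_eventually)
qed

text \<open>By the fundamental theorem of calculus the error on a cell with right end
  \<open>v\<close> is the integral of \<open>(q v - q s) * f' s\<close>: a small oscillation times a
  bounded derivative over a length \<open>t / n\<close>. From \<open>q\<close> this takes only
  continuity, so \<open>q\<close> may be a Wiener path or \<open>X\<^sup>2\<close>.\<close>

lemma grid_null_stieltjes_step:
  fixes f f' q :: "real \<Rightarrow> real"
  assumes t: "0 < t" and q: "continuous_on {0..t} q" and f': "continuous_on {0..t} f'"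
    and d: "\<And>s. s \<in> {0..t} \<Longrightarrow> (f has_real_derivative f' s) (at s within {0..t})"
  shows "grid_null (\<lambda>n k. real n *
    ((f (grid t n (Suc k)) * q (grid t n (Suc k)) - f (grid t n k) * q (grid t n k)
       - integral {grid t n k..grid t n (Suc k)} (\<lambda>s. q s * f' s))
     - f (grid t n k) * (q (grid t n (Suc k)) - q (grid t n k))))"
  unfolding grid_null_def
proof (intro allI impI)
  fix \<epsilon> :: real assume e: "0 < \<epsilon>"
  have "bounded (f' ` {0..t})"
    using f' by (intro compact_imp_bounded compact_continuous_image) auto
  then obtain C where C: "\<forall>x\<in>{0..t}. \<bar>f' x\<bar> \<le> C"
    by (auto simp: bounded_iff)
  have C0: "0 \<le> C" using C t by (smt (verit) atLeastAtMost_iff)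
  \<comment> \<open>\<open>C + 1\<close> instead of \<open>C\<close> keeps the tolerance positive
    when the derivative bound is 0.\<close>
  have "0 < \<epsilon> / (t * (C + 1))" using t e C0 by simp
  from grid_oscillation[OF t q this]
  show "\<forall>\<^sub>F n in sequentially. \<forall>k<n. \<bar>real n *
    ((f (grid t n (Suc k)) * q (grid t n (Suc k)) - f (grid t n k) * q (grid t n k)
       - integral {grid t n k..grid t n (Suc k)} (\<lambda>s. q s * f' s))
     - f (grid t n k) * (q (grid t n (Suc k)) - q (grid t n k)))\<bar> \<le> \<epsilon>"
  proof eventually_elim
    case (elim n)
    show ?case
    proof (intro allI impI)
      fix k assume k: "k < n"
      let ?u = "grid t n k" and ?v = "grid t n (Suc k)"
      have sub: "{?u..?v} \<subseteq> {0..t}" by (rule grid_interval_subset[OF t k])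
      have uv: "?u \<le> ?v" by (rule grid_mono[OF t])
      have cq: "continuous_on {?u..?v} q" and cf: "continuous_on {?u..?v} f'"
        using q f' sub continuous_on_subset by blast+
      have "(f' has_integral (f ?v - f ?u)) {?u..?v}"
        using sub uv
        by (intro fundamental_theorem_of_calculus)
           (auto simp: has_real_derivative_iff_has_vector_derivative[symmetric] intro!: DERIV_subset[OF d])
      then have F: "integral {?u..?v} f' = f ?v - f ?u" by (rule integral_unique)
      have "integral {?u..?v} (\<lambda>s. (q ?v - q s) * f' s) =
          integral {?u..?v} (\<lambda>s. q ?v * f' s - q s * f' s)"
        by (simp add: algebra_simps)
      also have "\<dots> = integral {?u..?v} (\<lambda>s. q ?v * f' s) - integral {?u..?v} (\<lambda>s. q s * f' s)"
        by (intro integral_diff integrable_continuous_real continuous_intros cq cf)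
      also have "integral {?u..?v} (\<lambda>s. q ?v * f' s) = q ?v * (f ?v - f ?u)"
        using F by simp
      finally have I: "(f ?v * q ?v - f ?u * q ?u - integral {?u..?v} (\<lambda>s. q s * f' s)) - f ?u * (q ?v - q ?u)
         = integral {?u..?v} (\<lambda>s. (q ?v - q s) * f' s)"
        by (simp add: algebra_simps)
      have "\<bar>integral {?u..?v} (\<lambda>s. (q ?v - q s) * f' s)\<bar> \<le> (\<epsilon> / (t * (C + 1)) * C) * (?v - ?u)"
      proof (rule integral_deviation_bound[OF _ uv])
        show "continuous_on {?u..?v} (\<lambda>s. (q ?v - q s) * f' s)"
          by (intro continuous_intros cq cf)
        fix s assume s: "s \<in> {?u..?v}"
        show "\<bar>(q ?v - q s) * f' s\<bar> \<le> \<epsilon> / (t * (C + 1)) * C"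
          unfolding abs_mult using elim k s uv sub C C0 t e by (intro mult_mono) auto
      qed
      also have "\<dots> = \<epsilon> / real n * (C / (C + 1))"
        using t by (simp add: grid_Suc_diff)
      also have "\<dots> \<le> \<epsilon> / real n * 1"
        using C0 e by (intro mult_left_mono) auto
      finally have "real n * \<bar>integral {?u..?v} (\<lambda>s. (q ?v - q s) * f' s)\<bar> \<le> \<epsilon>"
        using k by (simp add: field_simps)
      then show "\<bar>real n * ((f ?v * q ?v - f ?u * q ?u - integral {?u..?v} (\<lambda>s. q s * f' s)) - f ?u * (q ?v - q ?u))\<bar> \<le> \<epsilon>"
        unfolding I by (simp add: abs_mult)
    qed
  qed
qed

text \<open>Pathwise integration by parts: the integrator may have infinite variation, and the limit
  exists because the integrand is C1. With \<open>q = B\<close> it evaluates the noise term of the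
  equation, with \<open>q = X\<^sup>2\<close> the sum of \<open>g\<close> against increments of
  \<open>X\<^sup>2\<close> in Ito's formula.\<close>

lemma stieltjes_sum_tendsto:
  fixes f f' q :: "real \<Rightarrow> real"
  assumes t: "0 < t" and q: "continuous_on {0..t} q" and f': "continuous_on {0..t} f'"
    and d: "\<And>s. s \<in> {0..t} \<Longrightarrow> (f has_real_derivative f' s) (at s within {0..t})"
  shows "(\<lambda>n. \<Sum>k<n. f (grid t n k) * (q (grid t n (Suc k)) - q (grid t n k)))
     \<longlonglongrightarrow> f t * q t - f 0 * q 0 - integral {0..t} (\<lambda>s. q s * f' s)" (is "_ \<longlonglongrightarrow> ?L")
proof -
  let ?r = "\<lambda>n k. (f (grid t n (Suc k)) * q (grid t n (Suc k)) - f (grid t n k) * q (grid t n k)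
       - integral {grid t n k..grid t n (Suc k)} (\<lambda>s. q s * f' s))
     - f (grid t n k) * (q (grid t n (Suc k)) - q (grid t n k))"
  have c: "continuous_on {0..t} (\<lambda>s. q s * f' s)" by (intro continuous_intros q f')
  have "(\<lambda>n. ?L - (\<Sum>k<n. ?r n k)) \<longlonglongrightarrow> ?L - 0"
    by (intro tendsto_diff tendsto_const grid_null_sum grid_null_stieltjes_step[OF t q f' d])
  moreover have "\<forall>\<^sub>F n in sequentially. ?L - (\<Sum>k<n. ?r n k)
     = (\<Sum>k<n. f (grid t n k) * (q (grid t n (Suc k)) - q (grid t n k)))"
    using eventually_gt_at_top[of 0]
  proof eventually_elim
    case (elim n)
    show ?case
      using sum_integral_grid[OF t c order_refl, of n] grid_end[OF elim, of t]
        sum_lessThan_telescope[of "\<lambda>k. f (grid t n k) * q (grid t n k)" n]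
      by (simp add: sum_subtractf)
  qed
  ultimately show ?thesis
    by (auto intro: Lim_transform_eventually)
qed

section \<open>A maximal inequality for discrete exponential martingales\<close>

text \<open>Completing the square: the exponential weight turns the centred normal density into the
  one with mean \<open>a * v\<close> and the same variance, whose mass is 1.\<close>

lemma nn_integral_normal_exp_martingale:
  assumes v: "0 < v"
  shows "(\<integral>\<^sup>+x. ennreal (exp (a * x - a\<^sup>2 * v / 2))
           \<partial>density lborel (\<lambda>x. ennreal (normal_density 0 (sqrt v) x))) = 1"
proof -
  have "normal_density 0 (sqrt v) x * exp (a * x - a\<^sup>2 * v / 2) = normal_density (a * v) (sqrt v) x" for x
  proof -
    have "- (x - 0)\<^sup>2 / (2 * (sqrt v)\<^sup>2) + (a * x - a\<^sup>2 * v / 2) = - (x - a * v)\<^sup>2 / (2 * (sqrt v)\<^sup>2)"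
      using v by (simp add: field_simps power2_eq_square)
    then show ?thesis
      unfolding normal_density_def by (simp add: exp_add[symmetric] mult.assoc)
  qed
  then have "(\<integral>\<^sup>+x. ennreal (exp (a * x - a\<^sup>2 * v / 2))
           \<partial>density lborel (\<lambda>x. ennreal (normal_density 0 (sqrt v) x)))
     = (\<integral>\<^sup>+x. ennreal (normal_density (a * v) (sqrt v) x) \<partial>lborel)"
    by (subst nn_integral_density) (auto simp: ennreal_mult'[symmetric])
  also have "\<dots> = ennreal 1"
    using v by (subst nn_integral_eq_integral) (auto simp: normal_density_nonneg)
  finally show ?thesis by simp
qed

text \<open>Logarithm of the Doleans exponential of the discrete integral of \<open>h\<close>
  against independent centred normal increments of variance \<open>v\<close>; the subtracted squares
  are the compensator. The exponential is a mean-one martingale when \<open>h i\<close> reads only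
  coordinates below \<open>i\<close>.\<close>

definition log_exp_mart :: "real \<Rightarrow> (nat \<Rightarrow> (nat \<Rightarrow> real) \<Rightarrow> real) \<Rightarrow> nat \<Rightarrow> (nat \<Rightarrow> real) \<Rightarrow> real" where
  "log_exp_mart v h j w = (\<Sum>i<j. h i w * w i - (h i w)\<^sup>2 * v / 2)"

text \<open>The function \<open>W\<close> in the proof is the exponential martingale frozen at the level \<open>exp x\<close>
  once it has exceeded that level; its expectation does not increase.\<close>

lemma exp_mart_maximal_PiM:
  fixes h :: "nat \<Rightarrow> (nat \<Rightarrow> real) \<Rightarrow> real"
  assumes v: "0 < v"
    and meas: "\<And>k n. k \<le> n \<Longrightarrow> h k \<in> borel_measurable (PiM {..<n} (\<lambda>_. borel))"
    and dep: "\<And>k w w'. (\<And>j. j < k \<Longrightarrow> w j = w' j) \<Longrightarrow> h k w = h k w'"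
  defines "\<mu> \<equiv> density lborel (\<lambda>x. ennreal (normal_density 0 (sqrt v) x))"
  shows "emeasure (PiM {..<n} (\<lambda>_. \<mu>))
     {w \<in> space (PiM {..<n} (\<lambda>_. \<mu>)). \<exists>j\<le>n. x < log_exp_mart v h j w} \<le> ennreal (exp (- x))"
proof -
  let ?L = "log_exp_mart v h"
  define W where "W n w = (if \<exists>j\<le>n. x < ?L j w then exp x else exp (?L n w))" for n w
  interpret \<mu>: prob_space \<mu>
    unfolding \<mu>_def using v by (intro prob_space_normal_density) simp
  interpret P: product_prob_space "\<lambda>_::nat. \<mu>" UNIV
    by unfold_locales
  have setsP: "sets (PiM {..<n} (\<lambda>_. \<mu>)) = sets (PiM {..<n} (\<lambda>_. borel))" for n
    by (intro sets_PiM_cong) (auto simp: \<mu>_def)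
  have measP: "f \<in> borel_measurable (PiM {..<n} (\<lambda>_. \<mu>)) \<longleftrightarrow> f \<in> borel_measurable (PiM {..<n} (\<lambda>_. borel))"
    for f :: "(nat \<Rightarrow> real) \<Rightarrow> real" and n
    by (simp add: measurable_cong_sets[OF setsP])
  have Lmeas: "?L j \<in> borel_measurable (PiM {..<n} (\<lambda>_. \<mu>))" if "j \<le> n" for j n
    unfolding log_exp_mart_def measP using that
    by (intro borel_measurable_sum borel_measurable_diff borel_measurable_times borel_measurable_divide
        borel_measurable_power meas measurable_component_singleton borel_measurable_const) auto
  have hitmeas: "Measurable.pred (PiM {..<n} (\<lambda>_. \<mu>)) (\<lambda>w. \<exists>j\<le>m. x < ?L j w)" if "m \<le> n" for m n
  proof -
    have [measurable]: "j \<in> {..m} \<Longrightarrow> ?L j \<in> borel_measurable (PiM {..<n} (\<lambda>_. \<mu>))" for j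
      using Lmeas that by auto
    have "Measurable.pred (PiM {..<n} (\<lambda>_. \<mu>)) (\<lambda>w. \<exists>j\<in>{..m}. x < ?L j w)"
      by measurable
    then show ?thesis by (simp add: Bex_def)
  qed
  have Wmeas: "W m \<in> borel_measurable (PiM {..<n} (\<lambda>_. \<mu>))" if "m \<le> n" for m n
    unfolding W_def using hitmeas[OF that] Lmeas[OF that] by measurable
  have Lupd: "?L j (w(n := y)) = ?L j w" if "j \<le> n" for j n w y
    unfolding log_exp_mart_def
  proof (intro sum.cong refl)
    fix i assume "i \<in> {..<j}"
    then have "i < n" using that by auto
    then have "h i (w(n := y)) = h i w" by (intro dep) auto
    then show "h i (w(n := y)) * (w(n := y)) i - (h i (w(n := y)))\<^sup>2 * v / 2 = h i w * w i - (h i w)\<^sup>2 * v / 2"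
      using \<open>i < n\<close> by simp
  qed
  have EW: "(\<integral>\<^sup>+w. ennreal (W n w) \<partial>PiM {..<n} (\<lambda>_. \<mu>)) \<le> 1" for n
  proof (induction n)
    case 0
    interpret E: prob_space "PiM {..<0::nat} (\<lambda>_. \<mu>)" by (intro prob_space_PiM) unfold_locales
    have "(\<integral>\<^sup>+w. ennreal (W 0 w) \<partial>PiM {..<0} (\<lambda>_. \<mu>)) \<le> (\<integral>\<^sup>+w. 1 \<partial>PiM {..<0::nat} (\<lambda>_. \<mu>))"
      by (intro nn_integral_mono) (auto simp: W_def log_exp_mart_def)
    then show ?case by (simp only: nn_integral_const E.emeasure_space_1) simp
  next
    case (Suc n)
    \<comment> \<open>Integrating out coordinate \<open>n\<close> alone replaces conditioning on the
      first \<open>n\<close> increments.\<close>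
    have "(\<integral>\<^sup>+w. ennreal (W (Suc n) w) \<partial>PiM {..<Suc n} (\<lambda>_. \<mu>))
        = (\<integral>\<^sup>+w. (\<integral>\<^sup>+y. ennreal (W (Suc n) (w(n := y))) \<partial>\<mu>) \<partial>PiM {..<n} (\<lambda>_. \<mu>))"
      using Wmeas[of "Suc n" "Suc n"] unfolding lessThan_Suc
      by (intro P.product_nn_integral_insert) auto
    also have "\<dots> \<le> (\<integral>\<^sup>+w. ennreal (W n w) \<partial>PiM {..<n} (\<lambda>_. \<mu>))"
    proof (intro nn_integral_mono)
      fix w
      show "(\<integral>\<^sup>+y. ennreal (W (Suc n) (w(n := y))) \<partial>\<mu>) \<le> ennreal (W n w)"
      proof (cases "\<exists>j\<le>n. x < ?L j w")
        case True
        then have "W (Suc n) (w(n := y)) = exp x" for y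
          unfolding W_def using Lupd by (metis le_SucI)
        moreover have "W n w = exp x" using True by (simp add: W_def)
        ultimately show ?thesis by (simp add: \<mu>.emeasure_space_1)
      next
        case False
        have "W (Suc n) (w(n := y)) \<le> exp (?L n w) * exp (h n w * y - (h n w)\<^sup>2 * v / 2)" for y
        proof -
          have hn: "h n (w(n := y)) = h n w" by (intro dep) auto
          have L: "?L (Suc n) (w(n := y)) = ?L n w + (h n w * y - (h n w)\<^sup>2 * v / 2)"
            using Lupd[of n n w y] unfolding log_exp_mart_def by (simp add: hn)
          \<comment> \<open>The level has not been exceeded up to \<open>n\<close>, so freezing at
            step \<open>Suc n\<close> can only replace the exponential by the smaller value
            \<open>exp x\<close>.\<close>
          have "W (Suc n) (w(n := y)) \<le> exp (?L (Suc n) (w(n := y)))"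
          proof (cases "\<exists>j\<le>Suc n. x < ?L j (w(n := y))")
            case True
            then have "x < ?L (Suc n) (w(n := y))"
              using False Lupd by (metis le_Suc_eq)
            then show ?thesis using True by (simp add: W_def)
          qed (auto simp: W_def)
          then show ?thesis by (simp add: L exp_add[symmetric])
        qed
        then have "(\<integral>\<^sup>+y. ennreal (W (Suc n) (w(n := y))) \<partial>\<mu>)
          \<le> (\<integral>\<^sup>+y. ennreal (exp (?L n w)) * ennreal (exp (h n w * y - (h n w)\<^sup>2 * v / 2)) \<partial>\<mu>)"
          by (intro nn_integral_mono) (auto simp: ennreal_mult'[symmetric] intro!: ennreal_leI)
        also have "\<dots> = ennreal (exp (?L n w)) * (\<integral>\<^sup>+y. ennreal (exp (h n w * y - (h n w)\<^sup>2 * v / 2)) \<partial>\<mu>)"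
          by (intro nn_integral_cmult) (simp add: \<mu>_def)
        also have "\<dots> = ennreal (W n w)"
          unfolding \<mu>_def nn_integral_normal_exp_martingale[OF v] W_def using False by (simp only: if_False) simp
        finally show ?thesis .
      qed
    qed
    also have "\<dots> \<le> 1" by (rule Suc.IH)
    finally show ?case .
  qed
  let ?A = "{w \<in> space (PiM {..<n} (\<lambda>_. \<mu>)). \<exists>j\<le>n. x < ?L j w}"
  have A: "?A \<in> sets (PiM {..<n} (\<lambda>_. \<mu>))"
    using hitmeas[OF order_refl, of n] unfolding pred_def .
  have "ennreal (exp x) * emeasure (PiM {..<n} (\<lambda>_. \<mu>)) ?A
      = (\<integral>\<^sup>+w. ennreal (exp x) * indicator ?A w \<partial>PiM {..<n} (\<lambda>_. \<mu>))"
    using A by (rule nn_integral_cmult_indicator[symmetric])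
  also have "\<dots> \<le> (\<integral>\<^sup>+w. ennreal (W n w) \<partial>PiM {..<n} (\<lambda>_. \<mu>))"
    by (intro nn_integral_mono) (auto simp: W_def indicator_def)
  also have "\<dots> \<le> 1" by (rule EW)
  finally have *: "ennreal (exp x) * emeasure (PiM {..<n} (\<lambda>_. \<mu>)) ?A \<le> 1" .
  have "emeasure (PiM {..<n} (\<lambda>_. \<mu>)) ?A
     = ennreal (exp (- x)) * (ennreal (exp x) * emeasure (PiM {..<n} (\<lambda>_. \<mu>)) ?A)"
    by (subst mult.assoc[symmetric], subst ennreal_mult'[symmetric]) (simp_all add: exp_minus)
  also have "\<dots> \<le> ennreal (exp (- x)) * 1"
    using * by (intro mult_left_mono) auto
  finally show ?thesis by simp
qed

section \<open>Wiener increments and convergence in probability\<close>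

lemma wiener_process_grid:
  assumes W: "wiener_process M T B" and t: "0 < t" "ereal t < T" and n: "0 < n"
  shows "prob_space M"
    and "prob_space.indep_vars M (\<lambda>_. borel) (\<lambda>i \<omega>. B (grid t n (Suc i)) \<omega> - B (grid t n i) \<omega>) {..<n}"
    and "i < n \<Longrightarrow> distributed M lborel (\<lambda>\<omega>. B (grid t n (Suc i)) \<omega> - B (grid t n i) \<omega>)
          (\<lambda>x. ennreal (normal_density 0 (sqrt (t / real n)) x))"
proof -
  show M: "prob_space M" using W by (simp add: wiener_process_def)
  have strict: "grid t n i < grid t n j" if "i < j" for i j
    using t n that by (simp add: grid_def divide_strict_right_mono)
  have mem: "grid t n i \<in> time_dom T" if "i \<le> n" for i
    using grid_mem[OF t(1) that] t(2) by (auto simp: time_dom_def intro: le_less_trans[of _ "ereal t"])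
  define ts where "ts = map (grid t n) [0..<Suc n]"
  have ts: "ts \<noteq> []" "sorted_wrt (<) ts" "set ts \<subseteq> time_dom T" "length ts - 1 = n"
    using strict mem by (auto simp: ts_def sorted_wrt_iff_nth_less nth_append simp del: upt_Suc)
  have nth: "ts ! i = grid t n i" if "i \<le> n" for i
    using that by (simp add: ts_def nth_append del: upt_Suc)
  have "prob_space.indep_vars M (\<lambda>_. borel) (\<lambda>i \<omega>. B (ts ! Suc i) \<omega> - B (ts ! i) \<omega>) {..<length ts - 1}"
    using W ts(1-3) unfolding wiener_process_def by blast
  then show "prob_space.indep_vars M (\<lambda>_. borel) (\<lambda>i \<omega>. B (grid t n (Suc i)) \<omega> - B (grid t n i) \<omega>) {..<n}"
    unfolding ts(4)
    by (subst prob_space.indep_vars_cong[OF M refl, where Y = "\<lambda>i \<omega>. B (ts ! Suc i) \<omega> - B (ts ! i) \<omega>"])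
       (auto simp: nth)
  assume i: "i < n"
  show "distributed M lborel (\<lambda>\<omega>. B (grid t n (Suc i)) \<omega> - B (grid t n i) \<omega>)
          (\<lambda>x. ennreal (normal_density 0 (sqrt (t / real n)) x))"
    unfolding grid_Suc_diff[of t n i, symmetric]
    using W mem[of i] mem[of "Suc i"] strict[of i "Suc i"] i
    unfolding wiener_process_def by simp
qed

text \<open>Independence and normality identify the joint law of the grid increments with the
  product measure of the discrete inequality, and \<open>A\<close> is a preimage under the increment
  vector.\<close>

lemma wiener_exp_mart_maximal:
  fixes h :: "nat \<Rightarrow> (nat \<Rightarrow> real) \<Rightarrow> real" and x :: real
  assumes W: "wiener_process M T B" and t: "0 < t" "ereal t < T" and n: "0 < n"
    and meas: "\<And>k n. k \<le> n \<Longrightarrow> h k \<in> borel_measurable (PiM {..<n} (\<lambda>_. borel))"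
    and dep: "\<And>k w w'. (\<And>j. j < k \<Longrightarrow> w j = w' j) \<Longrightarrow> h k w = h k w'"
  defines "A \<equiv> {\<omega> \<in> space M. \<exists>j\<le>n. x < log_exp_mart (t / real n) h j
             (\<lambda>i. B (grid t n (Suc i)) \<omega> - B (grid t n i) \<omega>)}"
  shows "A \<in> sets M" "emeasure M A \<le> ennreal (exp (- x))"
proof -
  interpret prob_space M by (rule wiener_process_grid[OF W t n])
  let ?D = "\<lambda>i \<omega>. B (grid t n (Suc i)) \<omega> - B (grid t n i) \<omega>"
  let ?L = "log_exp_mart (t / real n) h"
  let ?R = "\<lambda>\<omega>. \<lambda>i\<in>{..<n}. ?D i \<omega>"
  define \<mu> where "\<mu> = density lborel (\<lambda>x. ennreal (normal_density 0 (sqrt (t / real n)) x))"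
  have D: "?D i \<in> borel_measurable M" if "i < n" for i
    using wiener_process_grid(3)[OF W t n that] by (simp add: distributed_def)
  have R: "?R \<in> measurable M (PiM {..<n} (\<lambda>_. borel))"
    using D by (intro measurable_restrict) auto
  have dist: "distr M borel (?D i) = \<mu>" if "i < n" for i
    using wiener_process_grid(3)[OF W t n that]
    by (simp add: distributed_def \<mu>_def cong: distr_cong)
  have "distr M (PiM {..<n} (\<lambda>_. borel)) ?R = PiM {..<n} (\<lambda>i. distr M borel (?D i))"
    using wiener_process_grid(2)[OF W t n] D n
    by (subst (asm) indep_vars_iff_distr_eq_PiM') auto
  also have "\<dots> = PiM {..<n} (\<lambda>_. \<mu>)"
    using dist by (intro PiM_cong) auto
  finally have dR: "distr M (PiM {..<n} (\<lambda>_. borel)) ?R = PiM {..<n} (\<lambda>_. \<mu>)" .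
  \<comment> \<open>\<open>?R \<omega>\<close> is truncated to indices below \<open>n\<close>; by
    \<open>dep\<close> the sum up to \<open>j \<le> n\<close> never reads the others.\<close>
  have L: "?L j (?R \<omega>) = ?L j (\<lambda>i. ?D i \<omega>)" if "j \<le> n" for j \<omega>
    unfolding log_exp_mart_def
  proof (intro sum.cong refl)
    fix i assume "i \<in> {..<j}"
    then have i: "i < n" using that by auto
    then have "h i (?R \<omega>) = h i (\<lambda>i. ?D i \<omega>)" by (intro dep) auto
    then show "h i (?R \<omega>) * ?R \<omega> i - (h i (?R \<omega>))\<^sup>2 * (t / real n) / 2
       = h i (\<lambda>i. ?D i \<omega>) * ?D i \<omega> - (h i (\<lambda>i. ?D i \<omega>))\<^sup>2 * (t / real n) / 2"
      using i by simp
  qed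
  let ?E = "{w \<in> space (PiM {..<n} (\<lambda>_. \<mu>)). \<exists>j\<le>n. x < ?L j w}"
  have spc: "space (PiM {..<n} (\<lambda>_. \<mu>)) = space (PiM {..<n} (\<lambda>_. borel))"
    by (intro sets_eq_imp_space_eq sets_PiM_cong) (auto simp: \<mu>_def)
  have AE: "A = ?R -` ?E \<inter> space M"
    using L measurable_space[OF R] by (auto simp: A_def spc)
  have Lm: "?L j \<in> borel_measurable (PiM {..<n} (\<lambda>_. borel))" if "j \<le> n" for j
    unfolding log_exp_mart_def using that
    by (intro borel_measurable_sum borel_measurable_diff borel_measurable_times borel_measurable_divide
        borel_measurable_power meas measurable_component_singleton borel_measurable_const) auto
  have "?E = (\<Union>j\<in>{..n}. {w \<in> space (PiM {..<n} (\<lambda>_. borel)). x < ?L j w})"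
    by (auto simp: spc)
  also have "\<dots> \<in> sets (PiM {..<n} (\<lambda>_. borel))"
    by (intro sets.finite_UN finite_atMost borel_measurable_less borel_measurable_const Lm) simp
  finally have E: "?E \<in> sets (PiM {..<n} (\<lambda>_. borel))" .
  show "A \<in> sets M" unfolding AE using R E by (rule measurable_sets)
  have "emeasure M A = emeasure (PiM {..<n} (\<lambda>_. \<mu>)) ?E"
    unfolding AE by (subst dR[symmetric], subst emeasure_distr[OF R E]) simp
  also have "\<dots> \<le> ennreal (exp (- x))"
    unfolding \<mu>_def
  proof (rule exp_mart_maximal_PiM)
    show "0 < t / real n" using t n by simp
  qed (fact meas dep)+
  finally show "emeasure M A \<le> ennreal (exp (- x))" .
qed

text \<open>Borel-Cantelli. The number \<open>(1/2)^k\<close> serves as tolerance and as bound for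
  the probability of exceeding it, so the probabilities are summable while the tolerance
  vanishes.\<close>

lemma conv_in_prob_AE_subseq:
  assumes "prob_space M" and Z: "conv_in_prob M Z I"
  shows "\<exists>r::nat \<Rightarrow> nat. strict_mono r \<and> (AE \<omega> in M. (\<lambda>n. Z (r n) \<omega>) \<longlonglongrightarrow> I \<omega>)"
proof -
  interpret prob_space M by fact
  have [measurable]: "Z n \<in> borel_measurable M" "I \<in> borel_measurable M" for n
    using Z by (auto simp: conv_in_prob_def)
  define A where "A \<epsilon> n = {\<omega>\<in>space M. \<epsilon> < \<bar>Z n \<omega> - I \<omega>\<bar>}" for \<epsilon> :: real and n
  have Am [measurable]: "A \<epsilon> n \<in> sets M" for \<epsilon> n unfolding A_def by measurable
  have A: "(\<lambda>n. measure M (A \<epsilon> n)) \<longlonglongrightarrow> 0" if "0 < \<epsilon>" for \<epsilon>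
    using Z that by (auto simp: conv_in_prob_def A_def)
  have ex: "\<exists>n>m. measure M (A ((1/2)^k) n) < (1/2)^k" for k m :: nat
  proof -
    have "\<forall>\<^sub>F n in sequentially. measure M (A ((1/2)^k) n) < (1/2)^k"
      by (intro order_tendstoD(2)[OF A]) auto
    from eventually_conj[OF this eventually_gt_at_top[of m]]
    show ?thesis using eventually_happens' sequentially_bot by fastforce
  qed
  have "\<exists>r. \<forall>k. (measure M (A ((1/2)^k) (r k)) < (1/2)^k) \<and> r k < r (Suc k)"
    by (rule dependent_nat_choice) (use ex in \<open>blast+\<close>)
  then obtain r where r: "\<And>k. measure M (A ((1/2)^k) (r k)) < (1/2)^k" "\<And>k. r k < r (Suc k)"
    by blast
  have mono: "strict_mono r" using r(2) by (simp add: strict_mono_Suc_iff)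
  have sum: "summable (\<lambda>k. measure M (A ((1/2)^k) (r k)))"
    by (rule summable_comparison_test'[of "\<lambda>k. (1/2)^k" 0]) (use r(1) less_imp_le in auto)
  have "AE \<omega> in M. \<forall>\<^sub>F k in sequentially. \<omega> \<in> space M - A ((1/2)^k) (r k)"
    by (rule borel_cantelli_AE1[OF _ _ sum]) (auto simp: less_top[symmetric])
  then have "AE \<omega> in M. (\<lambda>k. Z (r k) \<omega>) \<longlonglongrightarrow> I \<omega>"
  proof (rule AE_mp, intro AE_I2 impI)
    fix \<omega> assume "\<forall>\<^sub>F k in sequentially. \<omega> \<in> space M - A ((1/2)^k) (r k)"
    then have "\<forall>\<^sub>F k in sequentially. norm (Z (r k) \<omega> - I \<omega>) \<le> (1/2)^k"
      by eventually_elim (auto simp: A_def)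
    moreover have "(\<lambda>k. (1/2::real)^k) \<longlonglongrightarrow> 0" by (simp add: LIMSEQ_realpow_zero)
    ultimately have "(\<lambda>k. Z (r k) \<omega> - I \<omega>) \<longlonglongrightarrow> 0" by (rule Lim_null_comparison)
    then show "(\<lambda>k. Z (r k) \<omega>) \<longlonglongrightarrow> I \<omega>" by (simp add: LIM_zero_iff)
  qed
  with mono show ?thesis by blast
qed

lemma conv_in_prob_compose:
  assumes "conv_in_prob M Z I" "filterlim r at_top sequentially"
  shows "conv_in_prob M (\<lambda>n. Z (r n)) I"
  using assms filterlim_compose[of _ "nhds 0" at_top r sequentially]
  unfolding conv_in_prob_def by auto

text \<open>Subsequences are extracted one index after another. A common one is needed because sums
  of different kinds, or up to different times, must converge together along the same
  partitions.\<close>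

lemma conv_in_prob_finite_AE_subseq:
  assumes M: "prob_space M" and "finite J" and "\<And>i. i \<in> J \<Longrightarrow> conv_in_prob M (Z i) (I i)"
  shows "\<exists>r::nat \<Rightarrow> nat. strict_mono r \<and> (AE \<omega> in M. \<forall>i\<in>J. (\<lambda>n. Z i (r n) \<omega>) \<longlonglongrightarrow> I i \<omega>)"
  using assms(2,3)
proof (induction J rule: finite_induct)
  case empty
  show ?case by (intro exI[of _ id] conjI AE_I2) (simp_all add: strict_mono_def)
next
  case (insert i J)
  then obtain r where r: "strict_mono r" "AE \<omega> in M. \<forall>i\<in>J. (\<lambda>n. Z i (r n) \<omega>) \<longlonglongrightarrow> I i \<omega>"
    by auto
  have "conv_in_prob M (\<lambda>n. Z i (r n)) (I i)"
    by (rule conv_in_prob_compose[OF insert.prems filterlim_subseq[OF r(1)]]) simp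
  from conv_in_prob_AE_subseq[OF M this] obtain q
    where q: "strict_mono q" "AE \<omega> in M. (\<lambda>n. Z i (r (q n)) \<omega>) \<longlonglongrightarrow> I i \<omega>" by blast
  have "AE \<omega> in M. \<forall>j\<in>insert i J. (\<lambda>n. Z j ((r \<circ> q) n) \<omega>) \<longlonglongrightarrow> I j \<omega>"
    using r(2) q(2)
  proof eventually_elim
    case (elim \<omega>)
    then show ?case
      using LIMSEQ_subseq_LIMSEQ[OF _ q(1)] by (auto simp: comp_def)
  qed
  then show ?case using strict_mono_o[OF r(1) q(1)] by blast
qed

text \<open>A law of large numbers in mean square. The centred squares \<open>?U\<close> are
  independent with variance \<open>2 * (t / n)\<^sup>2\<close>, so only the diagonal of the squared
  sum survives and its mean is \<open>O(1/n)\<close>; Markov's inequality finishes. The weights will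
  be the values of \<open>g * \<sigma>\<^sup>2\<close> on the grid.\<close>

lemma conv_in_prob_quadratic_variation:
  assumes W: "wiener_process M T B" and t: "0 < t" "ereal t < T"
    and a: "grid_bdd a"
  shows "conv_in_prob M (\<lambda>n \<omega>. \<Sum>k<n. a n k * ((B (grid t n (Suc k)) \<omega> - B (grid t n k) \<omega>)\<^sup>2 - t / real n)) (\<lambda>_. 0)"
proof -
  interpret prob_space M using W by (simp add: wiener_process_def)
  let ?D = "\<lambda>n i \<omega>. B (grid t n (Suc i)) \<omega> - B (grid t n i) \<omega>"
  let ?U = "\<lambda>n i \<omega>. (?D n i \<omega>)\<^sup>2 - t / real n"
  let ?Q = "\<lambda>n \<omega>. \<Sum>k<n. a n k * ?U n k \<omega>"
  obtain C where C: "C \<ge> 0" "\<And>n k. k < n \<Longrightarrow> \<bar>a n k\<bar> \<le> C"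
    using a by (auto simp: grid_bdd_def)
  have Dm: "?D n i \<in> borel_measurable M" if "i < n" for i n
  proof -
    have "0 < n" using that by simp
    from wiener_process_grid(3)[OF W t this that] show ?thesis by (simp add: distributed_def)
  qed
  have Qm: "?Q n \<in> borel_measurable M" for n
    by (intro borel_measurable_sum borel_measurable_times borel_measurable_diff[OF borel_measurable_power]
        borel_measurable_const Dm) auto
  have mom: "integrable M (\<lambda>\<omega>. ?D n i \<omega> ^ k)"
      "(\<integral>\<omega>. ?D n i \<omega> ^ 2 \<partial>M) = t / real n"
      "(\<integral>\<omega>. ?D n i \<omega> ^ 4 \<partial>M) = 3 * (t / real n)\<^sup>2" if i: "i < n" for n i k
  proof -
    have n: "0 < n" using i by simp
    let ?v = "t / real n"
    have v: "0 < ?v" using t n by simp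
    note d = wiener_process_grid(3)[OF W t n i]
    have "integrable lborel (\<lambda>x. normal_density 0 (sqrt ?v) x * x ^ k)"
      using integrable_normal_moment[of "sqrt ?v" 0 k] v by simp
    then show "integrable M (\<lambda>\<omega>. ?D n i \<omega> ^ k)"
      using distributed_integrable[OF d, of "\<lambda>x. x ^ k"] by simp
    have "(\<integral>\<omega>. ?D n i \<omega> ^ 2 \<partial>M) = (\<integral>x. normal_density 0 (sqrt ?v) x * x ^ 2 \<partial>lborel)"
      using distributed_integral[OF d, of "\<lambda>x. x ^ 2"] by simp
    also have "\<dots> = ?v"
      using integral_normal_moment_even[of "sqrt ?v" 0 1] v by (simp add: fact_numeral)
    finally show "(\<integral>\<omega>. ?D n i \<omega> ^ 2 \<partial>M) = ?v" .
    have "(\<integral>\<omega>. ?D n i \<omega> ^ 4 \<partial>M) = (\<integral>x. normal_density 0 (sqrt ?v) x * x ^ 4 \<partial>lborel)"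
      using distributed_integral[OF d, of "\<lambda>x. x ^ 4"] by simp
    also have "\<dots> = fact 4 / ((2 / ?v)^2 * fact 2)"
      using integral_normal_moment_even[of "sqrt ?v" 0 2] v by simp
    also have "\<dots> = 3 * ?v\<^sup>2"
      using v by (simp add: fact_numeral power2_eq_square)
    finally show "(\<integral>\<omega>. ?D n i \<omega> ^ 4 \<partial>M) = 3 * ?v\<^sup>2" .
  qed
  have U: "integrable M (?U n i)" "(\<integral>\<omega>. ?U n i \<omega> \<partial>M) = 0"
      "integrable M (\<lambda>\<omega>. ?U n i \<omega> * ?U n i \<omega>)" "(\<integral>\<omega>. ?U n i \<omega> * ?U n i \<omega> \<partial>M) = 2 * (t / real n)\<^sup>2"
    if i: "i < n" for n i
  proof -
    show "integrable M (?U n i)" "(\<integral>\<omega>. ?U n i \<omega> \<partial>M) = 0"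
      using mom[OF i] by (auto simp: prob_space)
    have e: "?U n i \<omega> * ?U n i \<omega> = ?D n i \<omega> ^ 4 - 2 * (t / real n) * ?D n i \<omega> ^ 2 + (t / real n)\<^sup>2" for \<omega>
      by (simp add: power4_eq_xxxx power2_eq_square algebra_simps)
    show "integrable M (\<lambda>\<omega>. ?U n i \<omega> * ?U n i \<omega>)"
      unfolding e using mom(1)[OF i] by (intro Bochner_Integration.integrable_add
        Bochner_Integration.integrable_diff integrable_mult_right) auto
    show "(\<integral>\<omega>. ?U n i \<omega> * ?U n i \<omega> \<partial>M) = 2 * (t / real n)\<^sup>2"
      unfolding e using mom(1)[OF i, of 2] mom(1)[OF i, of 4] mom(2,3)[OF i]
      by (simp add: prob_space, simp add: power2_eq_square field_simps)
  qed
  have cross: "integrable M (\<lambda>\<omega>. ?U n i \<omega> * ?U n j \<omega>)" "(\<integral>\<omega>. ?U n i \<omega> * ?U n j \<omega> \<partial>M) = 0"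
    if ij: "i < n" "j < n" "i \<noteq> j" for n i j
  proof -
    have n: "0 < n" using ij by simp
    have "indep_vars (\<lambda>_. borel) (?D n) {i, j}"
      by (rule indep_vars_subset[OF wiener_process_grid(2)[OF W t n]]) (use ij in auto)
    then have ind: "indep_vars (\<lambda>_. borel) (\<lambda>i \<omega>. ?U n i \<omega>) {i, j}"
      by (rule indep_vars_compose2[where Y = "\<lambda>_ x. x\<^sup>2 - t / real n"]) auto
    have "integrable M (\<lambda>\<omega>. \<Prod>k\<in>{i,j}. ?U n k \<omega>)"
      by (rule indep_vars_integrable[OF _ ind]) (use U ij in auto)
    then show "integrable M (\<lambda>\<omega>. ?U n i \<omega> * ?U n j \<omega>)" using ij by simp
    have "(\<integral>\<omega>. (\<Prod>k\<in>{i,j}. ?U n k \<omega>) \<partial>M) = (\<Prod>k\<in>{i,j}. \<integral>\<omega>. ?U n k \<omega> \<partial>M)"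
      by (rule indep_vars_lebesgue_integral[OF _ ind]) (use U ij in auto)
    then show "(\<integral>\<omega>. ?U n i \<omega> * ?U n j \<omega> \<partial>M) = 0" using ij U(2)[of i n] by simp
  qed
  have Q2: "integrable M (\<lambda>\<omega>. (?Q n \<omega>)\<^sup>2)" "(\<integral>\<omega>. (?Q n \<omega>)\<^sup>2 \<partial>M) \<le> C\<^sup>2 * 2 * t\<^sup>2 / real n" for n
  proof -
    have e: "(?Q n \<omega>)\<^sup>2 = (\<Sum>i<n. \<Sum>j<n. a n i * a n j * (?U n i \<omega> * ?U n j \<omega>))" for \<omega>
      unfolding power2_eq_square sum_product by (intro sum.cong refl) (simp add: algebra_simps)
    have int: "integrable M (\<lambda>\<omega>. ?U n i \<omega> * ?U n j \<omega>)" if "i < n" "j < n" for i j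
      using U(3) cross(1) that by (cases "i = j") auto
    show "integrable M (\<lambda>\<omega>. (?Q n \<omega>)\<^sup>2)"
      unfolding e using int by (intro Bochner_Integration.integrable_sum integrable_mult_right) auto
    have "(\<integral>\<omega>. (?Q n \<omega>)\<^sup>2 \<partial>M) = (\<Sum>i<n. \<Sum>j<n. a n i * a n j * (\<integral>\<omega>. ?U n i \<omega> * ?U n j \<omega> \<partial>M))"
      unfolding e using int
      by (subst Bochner_Integration.integral_sum; (intro Bochner_Integration.integrable_sum sum.cong refl)?)
         (auto simp: Bochner_Integration.integral_sum)
    also have "\<dots> = (\<Sum>i<n. \<Sum>j<n. if j = i then (a n i)\<^sup>2 * (2 * (t / real n)\<^sup>2) else 0)"
    proof (intro sum.cong refl)
      fix i j assume "i \<in> {..<n}" "j \<in> {..<n}"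
      then show "a n i * a n j * (\<integral>\<omega>. ?U n i \<omega> * ?U n j \<omega> \<partial>M)
         = (if j = i then (a n i)\<^sup>2 * (2 * (t / real n)\<^sup>2) else 0)"
        using U(4)[of i n] cross(2)[of i n j]
        by (cases "i = j") (auto simp: power2_eq_square)
    qed
    also have "\<dots> = (\<Sum>i<n. (a n i)\<^sup>2 * (2 * (t / real n)\<^sup>2))"
      by (intro sum.cong refl) simp
    also have "\<dots> \<le> (\<Sum>i<n. C\<^sup>2 * (2 * (t / real n)\<^sup>2))"
      using C by (intro sum_mono mult_right_mono) (auto simp: abs_le_square_iff[symmetric])
    also have "\<dots> \<le> C\<^sup>2 * 2 * t\<^sup>2 / real n"
      by (cases "n = 0") (auto simp: power2_eq_square)
    finally show "(\<integral>\<omega>. (?Q n \<omega>)\<^sup>2 \<partial>M) \<le> C\<^sup>2 * 2 * t\<^sup>2 / real n" .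
  qed
  show ?thesis
    unfolding conv_in_prob_def
  proof (intro conjI allI impI Qm)
    fix \<epsilon> :: real assume e: "0 < \<epsilon>"
    have bound: "measure M {\<omega>\<in>space M. \<epsilon> < \<bar>?Q n \<omega> - 0\<bar>} \<le> (C\<^sup>2 * 2 * t\<^sup>2 / \<epsilon>\<^sup>2) / real n" for n
    proof -
      have "measure M {\<omega>\<in>space M. \<epsilon> < \<bar>?Q n \<omega> - 0\<bar>} \<le> measure M {\<omega>\<in>space M. \<epsilon>\<^sup>2 \<le> (?Q n \<omega>)\<^sup>2}"
        using Qm[of n] e by (intro finite_measure_mono) (auto simp: abs_le_square_iff[symmetric])
      also have "\<dots> \<le> (\<integral>\<omega>. (?Q n \<omega>)\<^sup>2 \<partial>M) / \<epsilon>\<^sup>2"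
        using e Q2(1)[of n] by (intro integral_Markov_inequality_measure[where A = "{}"]) auto
      also have "\<dots> \<le> (C\<^sup>2 * 2 * t\<^sup>2 / real n) / \<epsilon>\<^sup>2"
        by (intro divide_right_mono Q2) auto
      finally show ?thesis by (simp add: field_simps)
    qed
    have lim: "(\<lambda>n. (C\<^sup>2 * 2 * t\<^sup>2 / \<epsilon>\<^sup>2) / real n) \<longlonglongrightarrow> 0" by (rule lim_const_over_n)
    show "(\<lambda>n. measure M {\<omega>\<in>space M. \<epsilon> < \<bar>?Q n \<omega> - 0\<bar>}) \<longlonglongrightarrow> 0"
      by (rule tendsto_sandwich[OF _ _ tendsto_const lim]) (rule always_eventually, rule allI, rule measure_nonneg bound)+
  qed simp
qed

section \<open>The Euler scheme along a path\<close>

text \<open>With the increments \<open>w\<close> as an argument, the scheme can be read both as a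
  measurable function on the product space and along a Wiener path. Step \<open>k\<close> uses only
  \<open>w j\<close> with \<open>j < k\<close>, which is the predictability demanded by the maximal
  inequality.\<close>

primrec euler :: "real \<Rightarrow> (real \<Rightarrow> real) \<Rightarrow> (real \<Rightarrow> real) \<Rightarrow> real \<Rightarrow> nat \<Rightarrow> nat \<Rightarrow> (nat \<Rightarrow> real) \<Rightarrow> real" where
  "euler \<alpha> b \<sigma> t n 0 w = 0"
| "euler \<alpha> b \<sigma> t n (Suc k) w =
     (1 + \<alpha> * b (grid t n k) * (t / real n)) * euler \<alpha> b \<sigma> t n k w + \<sigma> (grid t n k) * w k"

lemma euler_cong:
  "(\<And>j. j < k \<Longrightarrow> w j = w' j) \<Longrightarrow> euler \<alpha> b \<sigma> t n k w = euler \<alpha> b \<sigma> t n k w'"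
  by (induction k) auto

lemma euler_measurable:
  "k \<le> m \<Longrightarrow> (\<lambda>w. euler \<alpha> b \<sigma> t n k w) \<in> borel_measurable (PiM {..<m} (\<lambda>_. borel))"
proof (induction k)
  case (Suc k)
  have [measurable]: "euler \<alpha> b \<sigma> t n k \<in> borel_measurable (PiM {..<m} (\<lambda>_. borel))"
    using Suc by simp
  have [measurable]: "(\<lambda>w. w k) \<in> borel_measurable (PiM {..<m} (\<lambda>_. borel))"
    using Suc.prems by (intro measurable_component_singleton) auto
  show ?case unfolding euler.simps by measurable
next
  case 0
  have "euler \<alpha> b \<sigma> t n 0 = (\<lambda>w. 0)" by (rule ext) simp
  then show ?case by simp
qed

text \<open>The grid of \<open>[0, grid t m i]\<close> with \<open>i * r\<close> cells and that of
  \<open>[0, t]\<close> with \<open>m * r\<close> cells have the same mesh, so a single scheme, and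
  hence a single exponential martingale, serves all intermediate times.\<close>

lemma euler_refine:
  assumes "0 < i"
  shows "euler \<alpha> b \<sigma> (grid t m i) (i * r) k w = euler \<alpha> b \<sigma> t (m * r) k w"
proof (induction k)
  case (Suc k)
  have "grid t m i / real (i * r) = t / real (m * r)"
    using assms by (simp add: grid_def)
  then show ?case using Suc by (simp only: euler.simps grid_refine[OF assms])
qed simp

text \<open>A step multiplies the error by at most \<open>1 + A / n\<close> and adds at most
  \<open>\<delta> / n\<close>. By step \<open>n\<close> the additions total \<open>\<delta>\<close>
  and the growth factor is at most \<open>(1 + A / n) ^ n \<le> exp A\<close>.\<close>

lemma discrete_gronwall:
  assumes e0: "\<And>n. e n 0 = 0"
    and eS: "\<And>n k. k < n \<Longrightarrow> e n (Suc k) = (1 + a n k / real n) * e n k + r n k"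
    and a: "grid_bdd a" and r: "grid_null (\<lambda>n k. real n * r n k)" and \<epsilon>: "0 < \<epsilon>"
  shows "\<forall>\<^sub>F n in sequentially. \<forall>k\<le>n. \<bar>e n k\<bar> \<le> \<epsilon>"
proof -
  obtain A where A: "A \<ge> 0" "\<And>n k. k < n \<Longrightarrow> \<bar>a n k\<bar> \<le> A"
    using a by (auto simp: grid_bdd_def)
  define \<delta> where "\<delta> = \<epsilon> / exp A"
  have \<delta>: "0 < \<delta>" using \<epsilon> by (simp add: \<delta>_def)
  from grid_nullD[OF r this] eventually_gt_at_top[of 0] show ?thesis
  proof eventually_elim
    case (elim n)
    let ?q = "1 + A / real n"
    have q: "1 \<le> ?q" using A by simp
    have *: "\<bar>e n k\<bar> \<le> (real k * \<delta> / real n) * ?q ^ k" if "k \<le> n" for k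
      using that
    proof (induction k)
      case (Suc k)
      have k: "k < n" using Suc.prems by simp
      have "\<bar>1 + a n k / real n\<bar> \<le> ?q"
        using A(2)[OF k] elim(2) by (intro order_trans[OF abs_triangle_ineq]) (simp add: divide_right_mono)
      moreover have "\<bar>r n k\<bar> \<le> \<delta> / real n"
        using elim k by (simp add: abs_mult field_simps)
      moreover have "\<bar>e n (Suc k)\<bar> \<le> \<bar>1 + a n k / real n\<bar> * \<bar>e n k\<bar> + \<bar>r n k\<bar>"
        unfolding eS[OF k] abs_mult[symmetric] by (rule abs_triangle_ineq)
      ultimately have "\<bar>e n (Suc k)\<bar> \<le> ?q * ((real k * \<delta> / real n) * ?q ^ k) + \<delta> / real n"
        using Suc.IH k q by (smt (verit) mult_mono abs_ge_zero less_imp_le_nat)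
      \<comment> \<open>Since \<open>?q \<ge> 1\<close>, the newly added error may also be
        multiplied by the full power, which keeps the bound in closed form.\<close>
      also have "\<dots> \<le> (real k * \<delta> / real n) * ?q ^ Suc k + (\<delta> / real n) * ?q ^ Suc k"
        using one_le_power[OF q, of "Suc k"] \<delta> mult_left_mono[of 1 "?q ^ Suc k" "\<delta> / real n"]
        by (simp add: mult.left_commute)
      also have "\<dots> = (real (Suc k) * \<delta> / real n) * ?q ^ Suc k"
        by (simp only: of_nat_Suc distrib_right add_divide_distrib mult_1_left add.commute)
      finally show ?case .
    qed (simp add: e0)
    show ?case
    proof (intro allI impI)
      fix k assume k: "k \<le> n"
      have "?q ^ k \<le> ?q ^ n" using q k by (rule power_increasing[rotated])
      also have "\<dots> \<le> exp (A / real n) ^ n"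
        using q by (intro power_mono exp_ge_add_one_self) auto
      also have "\<dots> = exp A" using elim(2) by (simp add: exp_of_nat_mult[symmetric])
      finally have "(real k * \<delta> / real n) * ?q ^ k \<le> \<delta> * exp A"
        using k \<delta> q elim(2) by (intro mult_mono) (auto simp: field_simps)
      then show "\<bar>e n k\<bar> \<le> \<epsilon>" using *[OF k] by (simp add: \<delta>_def)
    qed
  qed
qed

section \<open>Pathwise analysis of the Euler error and of Ito's formula\<close>

lemma sum_by_parts:
  fixes f q :: "nat \<Rightarrow> real"
  shows "(\<Sum>k<n. f k * (q (Suc k) - q k)) = f n * q n - f 0 * q 0 - (\<Sum>k<n. (f (Suc k) - f k) * q (Suc k))"
  by (induction n) (auto simp: algebra_simps)

text \<open>Everything here concerns one fixed path. Because \<open>\<sigma>\<close> is C1,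
  \<open>X_eq\<close> carries the noise term integrated by parts, free of stochastic integrals; its
  boundary term at 0 disappears because Wiener paths start at 0.\<close>

locale sde_path =
  fixes t \<alpha> :: real and b \<sigma> \<sigma>' g g' B X :: "real \<Rightarrow> real"
  assumes t: "0 < t"
    and b_cont: "continuous_on {0..t} b"
    and \<sigma>'_cont: "continuous_on {0..t} \<sigma>'"
    and \<sigma>_deriv: "\<And>s. s \<in> {0..t} \<Longrightarrow> (\<sigma> has_real_derivative \<sigma>' s) (at s within {0..t})"
    and g'_cont: "continuous_on {0..t} g'"
    and g_deriv: "\<And>s. s \<in> {0..t} \<Longrightarrow> (g has_real_derivative g' s) (at s within {0..t})"
    and B_cont: "continuous_on {0..t} B"
    and X_cont: "continuous_on {0..t} X"
    and X_0: "X 0 = 0"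
    and X_eq: "\<And>s. s \<in> {0..t} \<Longrightarrow> X s = integral {0..s} (\<lambda>u. \<alpha> * b u * X u)
          + (\<sigma> s * B s - integral {0..s} (\<lambda>u. B u * \<sigma>' u))"
begin

abbreviation incr :: "nat \<Rightarrow> nat \<Rightarrow> real" where
  "incr n \<equiv> \<lambda>i. B (grid t n (Suc i)) - B (grid t n i)"

abbreviation xe :: "nat \<Rightarrow> nat \<Rightarrow> real" where
  "xe n k \<equiv> euler \<alpha> b \<sigma> t n k (incr n)"

abbreviation err :: "nat \<Rightarrow> nat \<Rightarrow> real" where
  "err n k \<equiv> X (grid t n k) - xe n k"

definition rem :: "nat \<Rightarrow> nat \<Rightarrow> real" where
  "rem n k = X (grid t n (Suc k)) - X (grid t n k)
     - \<alpha> * b (grid t n k) * X (grid t n k) * (t / real n) - \<sigma> (grid t n k) * incr n k"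

lemma \<sigma>_cont: "continuous_on {0..t} \<sigma>" and g_cont: "continuous_on {0..t} g"
  by (rule DERIV_continuous_on[OF \<sigma>_deriv], simp, rule DERIV_continuous_on[OF g_deriv], simp)

text \<open>On each cell the remainder is the quadrature error of the drift plus the Stieltjes error
  of the noise, so it is \<open>o(1/n)\<close> although \<open>B\<close> is merely
  continuous.\<close>

lemma rem_null: "grid_null (\<lambda>n k. real n * rem n k)"
proof -
  let ?f = "\<lambda>u. \<alpha> * b u * X u" and ?q = "\<lambda>u. B u * \<sigma>' u"
  have fc: "continuous_on {0..t} ?f" and qc: "continuous_on {0..t} ?q"
    by (intro continuous_intros b_cont X_cont B_cont \<sigma>'_cont)+
  show ?thesis
  proof (rule grid_null_cong[OF grid_null_add[OF grid_null_riemann_step[OF t fc]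
            grid_null_stieltjes_step[OF t B_cont \<sigma>'_cont \<sigma>_deriv]]])
    fix n k :: nat assume k: "k < n"
    let ?u = "grid t n k" and ?v = "grid t n (Suc k)"
    have u: "?u \<in> {0..t}" and v: "?v \<in> {0..t}" using grid_mem[OF t] k by auto
    have split: "integral {0..?v} h = integral {0..?u} h + integral {?u..?v} h"
      if "continuous_on {0..t} h" for h :: "real \<Rightarrow> real"
      using u v grid_mono[OF t, of n k] continuous_on_subset[OF that]
      by (intro Henstock_Kurzweil_Integration.integral_combine[symmetric] integrable_continuous_real) auto
    show "real n * (integral {?u..?v} ?f - \<alpha> * b ?u * X ?u * (t / real n))
       + real n * (\<sigma> ?v * B ?v - \<sigma> ?u * B ?u - integral {?u..?v} ?q - \<sigma> ?u * (B ?v - B ?u))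
       = real n * rem n k"
      unfolding rem_def distrib_left[symmetric]
      using X_eq[OF u] X_eq[OF v] split[OF fc] split[OF qc]
      by (intro arg_cong2[of _ _ _ _ "(*)"] refl) linarith
  qed
qed

lemma err_Suc: "err n (Suc k) = (1 + (\<alpha> * b (grid t n k) * t) / real n) * err n k + rem n k"
  by (simp add: rem_def algebra_simps)

lemma grid_bdd_drift: "grid_bdd (\<lambda>n k. \<alpha> * b (grid t n k) * t)"
  using grid_bdd_continuous(1)[OF t, of "\<lambda>s. \<alpha> * b s * t"] b_cont
  by (simp add: continuous_intros)

lemma err_small:
  assumes "0 < \<epsilon>"
  shows "\<forall>\<^sub>F n in sequentially. \<forall>k\<le>n. \<bar>err n k\<bar> \<le> \<epsilon>"
  using discrete_gronwall[of err, OF _ err_Suc grid_bdd_drift rem_null assms] X_0 by simp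

lemma err_null: "grid_null err"
  unfolding grid_null_def
proof (intro allI impI)
  fix \<epsilon> :: real assume "0 < \<epsilon>"
  from err_small[OF this] show "\<forall>\<^sub>F n in sequentially. \<forall>k<n. \<bar>err n k\<bar> \<le> \<epsilon>"
    by eventually_elim auto
qed

lemma err_step_null: "grid_null (\<lambda>n k. real n * (err n (Suc k) - err n k))"
proof (rule grid_null_cong[OF grid_null_add[OF grid_null_mult_bdd[OF grid_bdd_drift err_null] rem_null]])
  fix n k :: nat assume "k < n"
  then show "\<alpha> * b (grid t n k) * t * err n k + real n * rem n k = real n * (err n (Suc k) - err n k)"
    unfolding err_Suc by (simp add: field_simps)
qed

text \<open>The absolute increments of \<open>B\<close> need not have bounded sums, so smallness of
  \<open>err\<close> alone does not suffice. Summation by parts moves the difference onto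
  \<open>g * \<sigma> * err\<close>, whose increments are \<open>o(1/n)\<close>: those of
  \<open>err\<close> by \<open>err_step_null\<close>, those of the Lipschitz factor because
  \<open>err\<close> is uniformly small.\<close>

lemma err_weighted_sum:
  "(\<lambda>n. \<Sum>k<n. g (grid t n k) * \<sigma> (grid t n k) * err n k * incr n k) \<longlonglongrightarrow> 0"
proof -
  let ?\<phi> = "\<lambda>s. g s * \<sigma> s" and ?\<phi>' = "\<lambda>s. g s * \<sigma>' s + g' s * \<sigma> s"
  have \<phi>'c: "continuous_on {0..t} ?\<phi>'" and \<phi>c: "continuous_on {0..t} ?\<phi>"
    by (intro continuous_intros \<sigma>_cont g_cont \<sigma>'_cont g'_cont)+
  let ?f = "\<lambda>n k. ?\<phi> (grid t n k) * err n k"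
  have step: "grid_null (\<lambda>n k. real n * ((?\<phi> (grid t n (Suc k)) - ?\<phi> (grid t n k)) * err n k))"
  proof -
    have d: "(?\<phi> has_real_derivative ?\<phi>' s) (at s within {0..t})" if "s \<in> {0..t}" for s
      using DERIV_mult[OF g_deriv[OF that] \<sigma>_deriv[OF that]] by (simp add: algebra_simps)
    obtain C where C: "\<forall>x\<in>{0..t}. \<bar>?\<phi>' x\<bar> \<le> C"
      using compact_imp_bounded[OF compact_continuous_image[OF \<phi>'c]] by (auto simp: bounded_iff)
    have "\<bar>real n * (?\<phi> (grid t n (Suc k)) - ?\<phi> (grid t n k))\<bar> \<le> C * t" if k: "k < n" for n k
    proof -
      have "norm (?\<phi> (grid t n (Suc k)) - ?\<phi> (grid t n k)) \<le> C * norm (grid t n (Suc k) - grid t n k)"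
        using C grid_mem[OF t] k
        by (intro field_differentiable_bound[of "{0..t}" ?\<phi> ?\<phi>'] d) auto
      then have "\<bar>?\<phi> (grid t n (Suc k)) - ?\<phi> (grid t n k)\<bar> \<le> C * t / real n"
        using t unfolding grid_Suc_diff by simp
      then show ?thesis using k unfolding abs_mult by (simp add: field_simps)
    qed
    moreover have "0 \<le> C * t" using C t by (smt (verit) atLeastAtMost_iff mult_nonneg_nonneg)
    ultimately have "grid_bdd (\<lambda>n k. real n * (?\<phi> (grid t n (Suc k)) - ?\<phi> (grid t n k)))"
      unfolding grid_bdd_def by blast
    from grid_null_mult_bdd[OF this err_null] show ?thesis by (simp add: mult.assoc)
  qed
  have fstep: "grid_null (\<lambda>n k. real n * (?f n (Suc k) - ?f n k))"
    by (rule grid_null_cong[OF grid_null_add[OF grid_null_mult_bdd[OF grid_bdd_continuous(2)[OF t \<phi>c]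
        err_step_null] step]]) (simp add: algebra_simps)
  have s: "(\<lambda>n. \<Sum>k<n. (?f n (Suc k) - ?f n k) * B (grid t n (Suc k))) \<longlonglongrightarrow> 0"
    by (rule grid_null_sum, rule grid_null_cong[OF grid_null_mult_bdd[OF grid_bdd_continuous(2)[OF t B_cont] fstep]])
       (simp add: algebra_simps)
  have "(\<lambda>n. err n n) \<longlonglongrightarrow> 0"
  proof (rule LIMSEQ_I)
    fix r :: real assume "0 < r"
    then have "0 < r / 2" by simp
    from err_small[OF this] have "\<forall>\<^sub>F n in sequentially. norm (err n n - 0) < r"
      by eventually_elim (use \<open>0 < r\<close> in force)
    then show "\<exists>no. \<forall>n\<ge>no. norm (err n n - 0) < r" by (simp add: eventually_sequentially)
  qed
  from tendsto_mult[OF tendsto_mult[OF tendsto_const[of "?\<phi> t"] this] tendsto_const[of "B t"]]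
  have "(\<lambda>n. ?\<phi> t * err n n * B t - (\<Sum>k<n. (?f n (Suc k) - ?f n k) * B (grid t n (Suc k)))) \<longlonglongrightarrow> 0 - 0"
    by (intro tendsto_diff s) simp
  moreover have "\<forall>\<^sub>F n in sequentially.
      ?\<phi> t * err n n * B t - (\<Sum>k<n. (?f n (Suc k) - ?f n k) * B (grid t n (Suc k)))
      = (\<Sum>k<n. g (grid t n k) * \<sigma> (grid t n k) * err n k * incr n k)"
    using eventually_gt_at_top[of 0]
  proof eventually_elim
    case (elim n)
    show ?case
      using sum_by_parts[where f = "?f n" and q = "\<lambda>k. B (grid t n k)" and n = n] grid_end[OF elim, of t] X_0
      by simp
  qed
  ultimately show ?thesis by (auto intro: Lim_transform_eventually)
qed

text \<open>Expanding the increment of \<open>X\<close> by \<open>rem_def\<close> leaves a drift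
  sum, a sum of remainders, and \<open>g * \<sigma> * X\<close> against \<open>incr\<close>; putting
  \<open>X = xe + err\<close> in the last gives the predictable sum plus a vanishing one. The drift
  sum later becomes \<open>\<alpha> * energy\<close>.\<close>

lemma riemann_sum_minus_euler_sum:
  "(\<lambda>n. (\<Sum>k<n. g (grid t n k) * X (grid t n k) * (X (grid t n (Suc k)) - X (grid t n k)))
       - (\<Sum>k<n. g (grid t n k) * \<sigma> (grid t n k) * xe n k * incr n k))
     \<longlonglongrightarrow> \<alpha> * integral {0..t} (\<lambda>s. g s * b s * (X s)\<^sup>2)"
proof -
  have c: "continuous_on {0..t} (\<lambda>s. g s * b s * (X s)\<^sup>2)" and gX: "continuous_on {0..t} (\<lambda>s. g s * X s)"
    by (intro continuous_intros g_cont b_cont X_cont)+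
  have "(\<lambda>n. \<Sum>k<n. g (grid t n k) * X (grid t n k) * rem n k) \<longlonglongrightarrow> 0"
    by (rule grid_null_sum, rule grid_null_cong[OF grid_null_mult_bdd[OF grid_bdd_continuous(1)[OF t gX] rem_null]])
       simp
  from tendsto_add[OF tendsto_add[OF tendsto_mult[OF tendsto_const[of \<alpha>] riemann_sum_tendsto_integral[OF t c]] this]
      err_weighted_sum]
  have "(\<lambda>n. \<alpha> * (\<Sum>k<n. g (grid t n k) * b (grid t n k) * (X (grid t n k))\<^sup>2 * (t / real n))
      + (\<Sum>k<n. g (grid t n k) * X (grid t n k) * rem n k)
      + (\<Sum>k<n. g (grid t n k) * \<sigma> (grid t n k) * err n k * incr n k))
      \<longlonglongrightarrow> \<alpha> * integral {0..t} (\<lambda>s. g s * b s * (X s)\<^sup>2)" by simp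
  moreover have "\<alpha> * (\<Sum>k<n. g (grid t n k) * b (grid t n k) * (X (grid t n k))\<^sup>2 * (t / real n))
      + (\<Sum>k<n. g (grid t n k) * X (grid t n k) * rem n k)
      + (\<Sum>k<n. g (grid t n k) * \<sigma> (grid t n k) * err n k * incr n k)
    = (\<Sum>k<n. g (grid t n k) * X (grid t n k) * (X (grid t n (Suc k)) - X (grid t n k)))
       - (\<Sum>k<n. g (grid t n k) * \<sigma> (grid t n k) * xe n k * incr n k)" for n
    unfolding sum_distrib_left sum.distrib[symmetric] sum_subtractf[symmetric]
    by (intro sum.cong refl) (simp add: rem_def power2_eq_square algebra_simps)
  ultimately show ?thesis by simp
qed

lemma euler_energy:
  "(\<lambda>n. \<Sum>k<n. (g (grid t n k) * \<sigma> (grid t n k) * xe n k)\<^sup>2 * (t / real n))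
     \<longlonglongrightarrow> integral {0..t} (\<lambda>s. (g s * \<sigma> s * X s)\<^sup>2)"
proof -
  have c: "continuous_on {0..t} (\<lambda>s. (g s * \<sigma> s * X s)\<^sup>2)"
    and c1: "continuous_on {0..t} (\<lambda>s. - 2 * t * (g s * \<sigma> s)\<^sup>2 * X s)"
    and c2: "continuous_on {0..t} (\<lambda>s. t * (g s * \<sigma> s)\<^sup>2)"
    by (intro continuous_intros g_cont \<sigma>_cont X_cont)+
  have eb: "grid_null (\<lambda>n k. err n k * err n k)"
    unfolding grid_null_def
  proof (intro allI impI)
    fix \<epsilon> :: real assume e: "0 < \<epsilon>"
    then have "0 < sqrt \<epsilon>" by simp
    from grid_nullD[OF err_null this]
    show "\<forall>\<^sub>F n in sequentially. \<forall>k<n. \<bar>err n k * err n k\<bar> \<le> \<epsilon>"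
    proof eventually_elim
      case (elim n)
      show ?case
      proof (intro allI impI)
        fix k assume "k < n"
        then have "\<bar>err n k\<bar> * \<bar>err n k\<bar> \<le> sqrt \<epsilon> * sqrt \<epsilon>"
          using elim e by (intro mult_mono) auto
        then show "\<bar>err n k * err n k\<bar> \<le> \<epsilon>" using e by (simp add: abs_mult)
      qed
    qed
  qed
  \<comment> \<open>From \<open>xe = X - err\<close>, the difference of squares is a multiple of
    \<open>- 2 * X * err + err\<^sup>2\<close>. The functions in \<open>c1\<close> and
    \<open>c2\<close> are its coefficients, including the factor \<open>t\<close> that remains of
    \<open>n * (t / n)\<close>.\<close>
  have "(\<lambda>n. \<Sum>k<n. ((g (grid t n k) * \<sigma> (grid t n k) * xe n k)\<^sup>2
        - (g (grid t n k) * \<sigma> (grid t n k) * X (grid t n k))\<^sup>2) * (t / real n)) \<longlonglongrightarrow> 0"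
    by (rule grid_null_sum, rule grid_null_cong[OF grid_null_add[OF
          grid_null_mult_bdd[OF grid_bdd_continuous(1)[OF t c1] err_null]
          grid_null_mult_bdd[OF grid_bdd_continuous(1)[OF t c2] eb]]])
       (simp add: power2_eq_square algebra_simps)
  from tendsto_add[OF riemann_sum_tendsto_integral[OF t c] this]
  show ?thesis by (simp add: sum.distrib[symmetric] algebra_simps)
qed

text \<open>The discrete Ito formula comes from
  \<open>x * (y - x) = (y\<^sup>2 - x\<^sup>2 - (y - x)\<^sup>2) / 2\<close>, with the squared
  increment of \<open>X\<close> replaced by that of \<open>\<sigma> * incr\<close>. The squared
  Wiener increments stay on the left because their limit is available in probability, not path by
  path.\<close>

lemma ito_sum:
  "(\<lambda>n. (\<Sum>k<n. g (grid t n k) * X (grid t n k) * (X (grid t n (Suc k)) - X (grid t n k)))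
       + (\<Sum>k<n. g (grid t n k) * (\<sigma> (grid t n k))\<^sup>2 * (incr n k)\<^sup>2) / 2)
     \<longlonglongrightarrow> (g t * (X t)\<^sup>2 - integral {0..t} (\<lambda>s. (X s)\<^sup>2 * g' s)) / 2"
proof -
  have X2: "continuous_on {0..t} (\<lambda>s. (X s)\<^sup>2)" by (intro continuous_intros X_cont)
  let ?dX = "\<lambda>n k. X (grid t n (Suc k)) - X (grid t n k)"
  \<comment> \<open>Of the two factors of the difference of squares, \<open>?\<rho> / n\<close>
    contains only drift and remainder and so is \<open>O(1/n)\<close>; the other is
    \<open>o(1)\<close> by continuity of the paths.\<close>
  let ?\<rho> = "\<lambda>n k. real n * (?dX n k - \<sigma> (grid t n k) * incr n k)"
  have bX: "continuous_on {0..t} (\<lambda>s. \<alpha> * b s * X s * t)"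
    by (intro continuous_intros b_cont X_cont)
  have null: "grid_null (\<lambda>n k. g (grid t n k) * (?dX n k + \<sigma> (grid t n k) * incr n k))"
    by (intro grid_null_mult_bdd grid_null_add grid_null_increment grid_bdd_continuous t g_cont \<sigma>_cont B_cont X_cont)
  have rho: "grid_null (\<lambda>n k. ?\<rho> n k * (g (grid t n k) * (?dX n k + \<sigma> (grid t n k) * incr n k)))"
  proof -
    \<comment> \<open>\<open>?\<rho>\<close> is \<open>n * rem\<close> plus a bounded drift term:
      the first product is null because of \<open>rem\<close>, the second because of
      \<open>null\<close>.\<close>
    have "grid_null (\<lambda>n k. real n * rem n k * (g (grid t n k) * (?dX n k + \<sigma> (grid t n k) * incr n k)))"
    proof -
      have "grid_bdd (\<lambda>n k. g (grid t n k) * (?dX n k + \<sigma> (grid t n k) * incr n k))"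
      proof -
        have "grid_bdd (\<lambda>n k. g (grid t n k) * ((X (grid t n (Suc k)) + (-1) * X (grid t n k)) + \<sigma> (grid t n k) * (B (grid t n (Suc k)) + (-1) * B (grid t n k))))"
          by (intro grid_bdd_mult grid_bdd_add grid_bdd_const grid_bdd_continuous t g_cont \<sigma>_cont B_cont X_cont)
        then show ?thesis by simp
      qed
      from grid_null_mult_bdd[OF this rem_null] show ?thesis by (simp add: mult_ac)
    qed
    from grid_null_add[OF this grid_null_mult_bdd[OF grid_bdd_continuous(1)[OF t bX] null]]
    show ?thesis
    proof (rule grid_null_cong)
      fix n k :: nat assume "k < n"
      then have "?\<rho> n k = real n * rem n k + \<alpha> * b (grid t n k) * X (grid t n k) * t"
        by (simp add: rem_def field_simps)
      then show "real n * rem n k * (g (grid t n k) * (?dX n k + \<sigma> (grid t n k) * incr n k)) +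
         \<alpha> * b (grid t n k) * X (grid t n k) * t * (g (grid t n k) * (?dX n k + \<sigma> (grid t n k) * incr n k))
         = ?\<rho> n k * (g (grid t n k) * (?dX n k + \<sigma> (grid t n k) * incr n k))"
        by (simp only: distrib_right)
    qed
  qed
  have "(\<lambda>n. \<Sum>k<n. g (grid t n k) * ((?dX n k)\<^sup>2 - (\<sigma> (grid t n k) * incr n k)\<^sup>2)) \<longlonglongrightarrow> 0"
    by (rule grid_null_sum, rule grid_null_cong[OF rho]) (simp add: power2_eq_square algebra_simps)
  from tendsto_divide[OF tendsto_diff[OF stieltjes_sum_tendsto[OF t X2 g'_cont g_deriv] this] tendsto_const[of 2]]
  have "(\<lambda>n. ((\<Sum>k<n. g (grid t n k) * ((X (grid t n (Suc k)))\<^sup>2 - (X (grid t n k))\<^sup>2))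
      - (\<Sum>k<n. g (grid t n k) * ((?dX n k)\<^sup>2 - (\<sigma> (grid t n k) * incr n k)\<^sup>2))) / 2)
      \<longlonglongrightarrow> (g t * (X t)\<^sup>2 - integral {0..t} (\<lambda>s. (X s)\<^sup>2 * g' s)) / 2"
    using X_0 by simp
  moreover have "((\<Sum>k<n. g (grid t n k) * ((X (grid t n (Suc k)))\<^sup>2 - (X (grid t n k))\<^sup>2))
      - (\<Sum>k<n. g (grid t n k) * ((?dX n k)\<^sup>2 - (\<sigma> (grid t n k) * incr n k)\<^sup>2))) / 2
    = (\<Sum>k<n. g (grid t n k) * X (grid t n k) * ?dX n k)
       + (\<Sum>k<n. g (grid t n k) * (\<sigma> (grid t n k))\<^sup>2 * (incr n k)\<^sup>2) / 2" for n
    unfolding sum_subtractf[symmetric] sum.distrib[symmetric] sum_divide_distrib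
    by (intro sum.cong refl) (simp add: power2_eq_square field_simps)
  ultimately show ?thesis by simp
qed

end

section \<open>Maximal inequality for the score process\<close>

lemma riemann_sum_grid:
  "riemann_sum H Y t n \<omega> = (\<Sum>k<n. H (grid t n k) \<omega> * (Y (grid t n (Suc k)) \<omega> - Y (grid t n k) \<omega>))"
  by (simp only: riemann_sum_def grid_def)

lemma interval_subset_time_dom: "ereal t < T \<Longrightarrow> {0..t} \<subseteq> time_dom T"
  by (auto simp: time_dom_def intro: le_less_trans[of _ "ereal t"])

lemma time_dom_right_nbhd:
  assumes "t \<in> time_dom T"
  obtains u where "t < u" "ereal u < T"
  using assms ereal_dense2[of "ereal t" T] by (auto simp: time_dom_def)

lemma has_real_derivative_integral_time_dom:
  fixes f :: "real \<Rightarrow> real"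
  assumes f: "continuous_on (time_dom T) f" and t: "t \<in> time_dom T"
  shows "((\<lambda>t. integral {0..t} f) has_real_derivative f t) (at t within time_dom T)"
proof -
  obtain u where u: "t < u" "ereal u < T" using time_dom_right_nbhd[OF t] .
  have "t \<in> {0..u}" using t u by (auto simp: time_dom_def)
  then have "((\<lambda>t. integral {0..t} f) has_real_derivative f t) (at t within {0..u})"
    by (intro integral_has_real_derivative
        continuous_on_subset[OF f interval_subset_time_dom[OF u(2)]])
  moreover have "at t within time_dom T = at t within {0..u}"
    using u interval_subset_time_dom[OF u(2)]
    by (intro at_within_nhd[of t "{..<u}"]) (auto simp: time_dom_def)
  ultimately show ?thesis by simp
qed

lemma continuous_on_integral_time_dom:
  fixes f :: "real \<Rightarrow> real"
  shows "continuous_on (time_dom T) f \<Longrightarrow> continuous_on (time_dom T) (\<lambda>t. integral {0..t} f)"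
  by (rule DERIV_continuous_on) (rule has_real_derivative_integral_time_dom)

text \<open>This turns an almost sure identity at each time into one at all times, at the cost of
  countably many null sets. Approximation from the right also reaches the left endpoint 0 of the
  time domain.\<close>

lemma continuous_on_eq_rationals:
  fixes f h :: "real \<Rightarrow> real"
  assumes f: "continuous_on U f" and h: "continuous_on U h"
    and U: "\<And>t. t \<in> U \<Longrightarrow> \<exists>u>t. {t..<u} \<subseteq> U"
    and eq: "\<And>q. q \<in> U \<Longrightarrow> q \<in> \<rat> \<Longrightarrow> f q = h q"
    and t: "t \<in> U"
  shows "f t = h t"
proof -
  obtain u where u: "t < u" "{t..<u} \<subseteq> U" using U[OF t] by blast
  have "\<exists>q. q \<in> \<rat> \<and> t < q \<and> q < min u (t + 1 / real (Suc n))" for n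
    using Rats_dense_in_real[of t "min u (t + 1 / real (Suc n))"] u by auto
  then obtain q where q: "\<And>n. q n \<in> \<rat>" "\<And>n. t < q n" "\<And>n. q n < min u (t + 1 / real (Suc n))"
    by metis
  have qU: "q n \<in> U" for n using q(2,3)[of n] u(2) by (auto simp: subset_eq)
  have lim: "q \<longlonglongrightarrow> t"
  proof (rule tendsto_sandwich[OF _ _ tendsto_const])
    show "(\<lambda>n. t + 1 / real (Suc n)) \<longlonglongrightarrow> t"
      using tendsto_add[OF tendsto_const[of t] LIMSEQ_inverse_real_of_nat] by (simp add: inverse_eq_divide)
    show "\<forall>\<^sub>F n in sequentially. t \<le> q n"
      using q(2) by (intro always_eventually allI less_imp_le)
    show "\<forall>\<^sub>F n in sequentially. q n \<le> t + 1 / real (Suc n)"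
      by (intro always_eventually allI) (use q(3) in \<open>simp add: less_imp_le\<close>)
  qed
  have "(\<lambda>n. f (q n)) \<longlonglongrightarrow> f t" "(\<lambda>n. h (q n)) \<longlonglongrightarrow> h t"
    using f h qU lim t by (auto simp: continuous_on_sequentially comp_def)
  moreover have "f (q n) = h (q n)" for n by (rule eq[OF qU q(1)])
  ultimately show ?thesis using LIMSEQ_unique by simp
qed

section \<open>Measure bounds for limits of events\<close>

lemma emeasure_UN_incseq_le:
  fixes A :: "nat \<Rightarrow> 'a set"
  assumes "\<And>j. A j \<in> sets M" "incseq A" "\<And>j. emeasure M (A j) \<le> c"
  shows "(\<Union>j. A j) \<in> sets M" "emeasure M (\<Union>j. A j) \<le> c"
proof -
  show "(\<Union>j. A j) \<in> sets M" using assms(1) by blast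
  have "(SUP j. emeasure M (A j)) = emeasure M (\<Union>j. A j)"
    using assms(1,2) by (intro SUP_emeasure_incseq) auto
  then show "emeasure M (\<Union>j. A j) \<le> c"
    using assms(3) by (metis SUP_least)
qed

text \<open>A Fatou-type bound: almost surely \<open>F\<close> lies in the lower limit of the
  \<open>A j\<close>, an increasing union of intersections each of measure at most \<open>c\<close>.
  It carries the discrete maximal inequality to the limit.\<close>

lemma emeasure_le_eventually:
  fixes A :: "nat \<Rightarrow> 'a set"
  assumes A: "\<And>j. A j \<in> sets M" and c: "\<And>j. emeasure M (A j) \<le> c"
    and F: "AE \<omega> in M. \<omega> \<in> F \<longrightarrow> (\<forall>\<^sub>F j in sequentially. \<omega> \<in> A j)"
  shows "emeasure M F \<le> c"
proof -
  let ?B = "\<lambda>K. \<Inter>k\<in>{K..}. A k"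
  have B: "?B K \<in> sets M" for K using A by (intro sets.countable_INT') auto
  have le: "emeasure M (?B K) \<le> c" for K
    using emeasure_mono[of "?B K" "A K" M] A c[of K] by (auto intro: order_trans)
  have inc: "incseq ?B" by (auto simp: incseq_def)
  have "AE \<omega> in M. \<omega> \<in> F \<longrightarrow> \<omega> \<in> (\<Union>K. ?B K)"
    using F by eventually_elim (auto simp: eventually_sequentially)
  then have "emeasure M F \<le> emeasure M (\<Union>K. ?B K)"
    using emeasure_UN_incseq_le(1)[OF B inc le] by (intro emeasure_mono_AE) auto
  also have "\<dots> \<le> c" by (rule emeasure_UN_incseq_le(2)[OF B inc le])
  finally show ?thesis .
qed

text \<open>Here \<open>g\<close> is any C1 function with \<open>b = g * \<sigma>\<^sup>2\<close>;
  the special shape of \<open>b\<close> enters only in \<open>bridge_sde\<close>. The continuous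
  paths of \<open>N\<close> on the open interval let events over uncountably many times be reduced
  to countable ones.\<close>

locale linear_sde =
  fixes M :: "'a measure" and T :: ereal and \<alpha> :: real and b \<sigma> \<sigma>' g g' :: "real \<Rightarrow> real"
    and B X N :: "real \<Rightarrow> 'a \<Rightarrow> real"
  assumes T: "0 < T"
    and b_cont: "continuous_on (time_dom T) b"
    and \<sigma>'_cont: "continuous_on (time_dom T) \<sigma>'"
    and \<sigma>_deriv: "\<And>s. s \<in> time_dom T \<Longrightarrow> (\<sigma> has_real_derivative \<sigma>' s) (at s within time_dom T)"
    and g'_cont: "continuous_on (time_dom T) g'"
    and g_deriv: "\<And>s. s \<in> time_dom T \<Longrightarrow> (g has_real_derivative g' s) (at s within time_dom T)"
    and b_eq: "\<And>s. s \<in> time_dom T \<Longrightarrow> b s = g s * (\<sigma> s)\<^sup>2"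
    and wiener: "wiener_process M T B"
    and solution: "strong_solution M T \<alpha> b \<sigma> B X"
    and N_integral: "\<And>t. t \<in> time_dom T \<Longrightarrow> 0 < t \<Longrightarrow> stoch_integral M (\<lambda>s \<omega>. g s * X s \<omega>) X t (N t)"
    and N_cont: "\<And>\<omega>. \<omega> \<in> space M \<Longrightarrow> continuous_on {t\<in>time_dom T. 0 < t} (\<lambda>t. N t \<omega>)"
begin

sublocale prob_space M
  using wiener by (simp add: wiener_process_def)

lemma \<sigma>_cont: "continuous_on (time_dom T) \<sigma>" and g_cont: "continuous_on (time_dom T) g"
  by (rule DERIV_continuous_on[OF \<sigma>_deriv], simp, rule DERIV_continuous_on[OF g_deriv], simp)

lemma B_cont: "\<omega> \<in> space M \<Longrightarrow> continuous_on (time_dom T) (\<lambda>t. B t \<omega>)"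
  and B_0: "\<omega> \<in> space M \<Longrightarrow> B 0 \<omega> = 0"
  using wiener by (auto simp: wiener_process_def)

lemma X_cont: "\<omega> \<in> space M \<Longrightarrow> continuous_on (time_dom T) (\<lambda>t. X t \<omega>)"
  and X_0: "\<omega> \<in> space M \<Longrightarrow> X 0 \<omega> = 0"
  and X_meas: "t \<in> time_dom T \<Longrightarrow> X t \<in> borel_measurable M"
  using solution by (auto simp: strong_solution_def)

text \<open>The Riemann sums of the deterministic C1 integrand converge along every path to the
  integrated-by-parts expression, and a subsequence converges almost surely to \<open>I\<close>; so
  both limits agree.\<close>

lemma X_eq_at:
  assumes t: "t \<in> time_dom T"
  shows "AE \<omega> in M. X t \<omega> = integral {0..t} (\<lambda>u. \<alpha> * b u * X u \<omega>)
          + (\<sigma> t * B t \<omega> - integral {0..t} (\<lambda>u. B u \<omega> * \<sigma>' u))"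
proof (cases "t = 0")
  case True
  then show ?thesis using X_0 B_0 by (intro AE_I2) auto
next
  case False
  then have t0: "0 < t" and tT: "ereal t < T" using t by (auto simp: time_dom_def)
  note sub = interval_subset_time_dom[OF tT]
  obtain I where I: "stoch_integral M (\<lambda>s \<omega>. \<sigma> s) B t I"
    "AE \<omega> in M. X t \<omega> = integral {0..t} (\<lambda>s. \<alpha> * b s * X s \<omega>) + I \<omega>"
    using solution t by (auto simp: strong_solution_def)
  from conv_in_prob_AE_subseq[OF prob_space_axioms I(1)[unfolded stoch_integral_def]]
  obtain r where r: "strict_mono r" "AE \<omega> in M. (\<lambda>n. riemann_sum (\<lambda>s \<omega>. \<sigma> s) B t (r n) \<omega>) \<longlonglongrightarrow> I \<omega>"
    by blast
  show ?thesis using r(2) I(2) AE_space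
  proof eventually_elim
    case (elim \<omega>)
    have "(\<lambda>n. riemann_sum (\<lambda>s \<omega>. \<sigma> s) B t n \<omega>)
       \<longlonglongrightarrow> \<sigma> t * B t \<omega> - \<sigma> 0 * B 0 \<omega> - integral {0..t} (\<lambda>s. B s \<omega> * \<sigma>' s)"
      unfolding riemann_sum_grid
      by (rule stieltjes_sum_tendsto[OF t0])
         (use sub B_cont[OF elim(3)] \<sigma>'_cont in \<open>auto intro: continuous_on_subset DERIV_subset[OF \<sigma>_deriv sub]\<close>)
    from LIMSEQ_subseq_LIMSEQ[OF this r(1)]
    have "I \<omega> = \<sigma> t * B t \<omega> - \<sigma> 0 * B 0 \<omega> - integral {0..t} (\<lambda>s. B s \<omega> * \<sigma>' s)"
      using elim(1) by (intro LIMSEQ_unique) (auto simp: comp_def)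
    then show ?case using elim B_0[OF elim(3)] by simp
  qed
qed

lemma AE_sde_path:
  "AE \<omega> in M. \<forall>t. 0 < t \<longrightarrow> ereal t < T \<longrightarrow> sde_path t \<alpha> b \<sigma> \<sigma>' g g' (\<lambda>s. B s \<omega>) (\<lambda>s. X s \<omega>)"
proof -
  let ?R = "\<lambda>\<omega> t. integral {0..t} (\<lambda>u. \<alpha> * b u * X u \<omega>) + (\<sigma> t * B t \<omega> - integral {0..t} (\<lambda>u. B u \<omega> * \<sigma>' u))"
  have "AE \<omega> in M. \<forall>q\<in>time_dom T \<inter> \<rat>. X q \<omega> = ?R \<omega> q"
    using X_eq_at by (subst AE_ball_countable) (auto intro: countable_rat countable_subset)
  then show ?thesis using AE_space
  proof eventually_elim
    case (elim \<omega>)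
    note XB = X_cont[OF elim(2)] B_cont[OF elim(2)]
    have eq: "X t \<omega> = ?R \<omega> t" if "t \<in> time_dom T" for t
    proof (rule continuous_on_eq_rationals[OF _ _ _ _ that])
      show "continuous_on (time_dom T) (\<lambda>t. ?R \<omega> t)"
        by (intro continuous_intros continuous_on_integral_time_dom \<sigma>_cont \<sigma>'_cont b_cont XB)
      show "\<exists>u>t. {t..<u} \<subseteq> time_dom T" if t: "t \<in> time_dom T" for t
      proof -
        obtain u where u: "t < u" "ereal u < T" using time_dom_right_nbhd[OF t] .
        then show ?thesis using interval_subset_time_dom[OF u(2)] t
          by (intro exI[of _ u]) (auto simp: time_dom_def subset_eq)
      qed
    qed (use XB elim in auto)
    show ?case
    proof (intro allI impI)
      fix t :: real assume t: "0 < t" "ereal t < T"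
      note sub = interval_subset_time_dom[OF t(2)]
      show "sde_path t \<alpha> b \<sigma> \<sigma>' g g' (\<lambda>s. B s \<omega>) (\<lambda>s. X s \<omega>)"
      proof
        fix s assume "s \<in> {0..t}"
        then have s: "s \<in> time_dom T" using sub by blast
        show "(\<sigma> has_real_derivative \<sigma>' s) (at s within {0..t})"
          "(g has_real_derivative g' s) (at s within {0..t})"
          using DERIV_subset[OF \<sigma>_deriv[OF s] sub] DERIV_subset[OF g_deriv[OF s] sub] by auto
        show "X s \<omega> = ?R \<omega> s" by (rule eq[OF s])
      qed (use t X_0[OF elim(2)] in \<open>auto intro!: continuous_on_subset[OF _ sub] b_cont \<sigma>'_cont g'_cont XB\<close>)
    qed
  qed
qed

section \<open>Energy, score process and Ito's formula\<close>

definition energy :: "real \<Rightarrow> 'a \<Rightarrow> real" where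
  "energy t \<omega> = integral {0..t} (\<lambda>s. (g s * \<sigma> s * X s \<omega>)\<^sup>2)"

lemma energy_cont: "\<omega> \<in> space M \<Longrightarrow> continuous_on (time_dom T) (\<lambda>t. energy t \<omega>)"
  unfolding energy_def
  by (intro continuous_on_integral_time_dom continuous_intros g_cont \<sigma>_cont X_cont)

lemma energy_meas:
  assumes t: "0 < t" "ereal t < T"
  shows "energy t \<in> borel_measurable M"
proof (rule borel_measurable_LIMSEQ_real)
  note sub = interval_subset_time_dom[OF t(2)]
  fix \<omega> assume \<omega>: "\<omega> \<in> space M"
  show "(\<lambda>n. \<Sum>k<n. (g (grid t n k) * \<sigma> (grid t n k) * X (grid t n k) \<omega>)\<^sup>2 * (t / real n)) \<longlonglongrightarrow> energy t \<omega>"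
    unfolding energy_def
    by (rule riemann_sum_tendsto_integral[OF t(1)])
       (intro continuous_intros continuous_on_subset[OF _ sub] g_cont \<sigma>_cont X_cont[OF \<omega>])
next
  fix n
  have "X (grid t n k) \<in> borel_measurable M" if "k < n" for k
    using grid_mem[OF t(1), of k n] that interval_subset_time_dom[OF t(2)] by (intro X_meas) auto
  then show "(\<lambda>\<omega>. \<Sum>k<n. (g (grid t n k) * \<sigma> (grid t n k) * X (grid t n k) \<omega>)\<^sup>2 * (t / real n)) \<in> borel_measurable M"
    by (intro borel_measurable_sum borel_measurable_times borel_measurable_power borel_measurable_const) auto
qed

lemma N_conv:
  assumes "0 < t" "ereal t < T"
  shows "conv_in_prob M (riemann_sum (\<lambda>s \<omega>. g s * X s \<omega>) X t) (N t)"
  using N_integral[of t] assms by (simp add: time_dom_def stoch_integral_def)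

lemma N_meas: "0 < t \<Longrightarrow> ereal t < T \<Longrightarrow> N t \<in> borel_measurable M"
  using N_conv by (auto simp: conv_in_prob_def)

text \<open>Probability closes the pathwise \<open>ito_sum\<close>: along a common subsequence the
  left sums tend to \<open>N t\<close> and the weighted squared increments to the integral of
  \<open>g * \<sigma>\<^sup>2 = b\<close>.\<close>

lemma ito_at:
  assumes t: "0 < t" "ereal t < T"
  shows "AE \<omega> in M. N t \<omega> = (g t * (X t \<omega>)\<^sup>2 - integral {0..t} (\<lambda>s. (X s \<omega>)\<^sup>2 * g' s) - integral {0..t} b) / 2"
proof -
  note sub = interval_subset_time_dom[OF t(2)]
  let ?a = "\<lambda>n k. g (grid t n k) * (\<sigma> (grid t n k))\<^sup>2"
  let ?V = "\<lambda>n \<omega>. \<Sum>k<n. ?a n k * ((B (grid t n (Suc k)) \<omega> - B (grid t n k) \<omega>)\<^sup>2 - t / real n)"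
  have ac: "continuous_on {0..t} (\<lambda>s. g s * (\<sigma> s)\<^sup>2)"
    by (intro continuous_intros continuous_on_subset[OF _ sub] g_cont \<sigma>_cont)
  have V: "conv_in_prob M ?V (\<lambda>_. 0)"
    by (rule conv_in_prob_quadratic_variation[OF wiener t grid_bdd_continuous(1)[OF t(1) ac]])
  \<comment> \<open>The Boolean index packs the two sequences into one finite family.\<close>
  have "\<exists>r. strict_mono r \<and> (AE \<omega> in M. \<forall>i\<in>UNIV.
      (\<lambda>n. (if i then riemann_sum (\<lambda>s \<omega>. g s * X s \<omega>) X t else ?V) (r n) \<omega>) \<longlonglongrightarrow> (if i then N t else (\<lambda>_. 0)) \<omega>)"
    using N_conv[OF t] V by (intro conv_in_prob_finite_AE_subseq prob_space_axioms) auto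
  then obtain r where r: "strict_mono r"
    "AE \<omega> in M. (\<lambda>n. riemann_sum (\<lambda>s \<omega>. g s * X s \<omega>) X t (r n) \<omega>) \<longlonglongrightarrow> N t \<omega> \<and> (\<lambda>n. ?V (r n) \<omega>) \<longlonglongrightarrow> 0"
    by (auto simp: UNIV_bool)
  show ?thesis using r(2) AE_sde_path
  proof eventually_elim
    case (elim \<omega>)
    interpret P: sde_path t \<alpha> b \<sigma> \<sigma>' g g' "\<lambda>s. B s \<omega>" "\<lambda>s. X s \<omega>"
      using elim(2) t by blast
    have "integral {0..t} (\<lambda>s. g s * (\<sigma> s)\<^sup>2) = integral {0..t} b"
      using b_eq sub by (intro integral_cong) auto
    with riemann_sum_tendsto_integral[OF t(1) ac]
    have "(\<lambda>n. \<Sum>k<n. ?a n k * (t / real n)) \<longlonglongrightarrow> integral {0..t} b" by simp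
    from tendsto_diff[OF LIMSEQ_subseq_LIMSEQ[OF P.ito_sum r(1)] tendsto_divide[OF tendsto_add[OF conjunct2[OF elim(1)]
        LIMSEQ_subseq_LIMSEQ[OF this r(1)]] tendsto_const[of 2]]]
    have "(\<lambda>n. riemann_sum (\<lambda>s \<omega>. g s * X s \<omega>) X t (r n) \<omega>) \<longlonglongrightarrow>
       (g t * (X t \<omega>)\<^sup>2 - integral {0..t} (\<lambda>s. (X s \<omega>)\<^sup>2 * g' s)) / 2 - (0 + integral {0..t} b) / 2"
      unfolding riemann_sum_grid
      by (simp add: comp_def sum.distrib[symmetric] algebra_simps)
    from LIMSEQ_unique[OF conjunct1[OF elim(1)] this]
    show ?case by (simp add: diff_divide_distrib)
  qed
qed

lemma AE_ito:
  "AE \<omega> in M. \<forall>t. 0 < t \<longrightarrow> ereal t < T \<longrightarrow>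
     N t \<omega> = (g t * (X t \<omega>)\<^sup>2 - integral {0..t} (\<lambda>s. (X s \<omega>)\<^sup>2 * g' s) - integral {0..t} b) / 2"
proof -
  let ?R = "\<lambda>\<omega> t. (g t * (X t \<omega>)\<^sup>2 - integral {0..t} (\<lambda>s. (X s \<omega>)\<^sup>2 * g' s) - integral {0..t} b) / 2"
  let ?U = "{t \<in> time_dom T. 0 < t}"
  have "AE \<omega> in M. \<forall>q\<in>?U \<inter> \<rat>. N q \<omega> = ?R \<omega> q"
    using ito_at by (subst AE_ball_countable) (auto simp: time_dom_def intro: countable_rat countable_subset)
  then show ?thesis using AE_space
  proof eventually_elim
    case (elim \<omega>)
    have "N t \<omega> = ?R \<omega> t" if "t \<in> ?U" for t
    proof (rule continuous_on_eq_rationals[OF _ _ _ _ that])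
      show "continuous_on ?U (\<lambda>t. N t \<omega>)" by (rule N_cont[OF elim(2)])
      have "continuous_on (time_dom T) (\<lambda>t. ?R \<omega> t)"
        by (intro continuous_intros continuous_on_integral_time_dom g_cont g'_cont b_cont X_cont[OF elim(2)]) simp
      then show "continuous_on ?U (\<lambda>t. ?R \<omega> t)" by (rule continuous_on_subset) auto
      show "\<exists>u>t. {t..<u} \<subseteq> ?U" if t: "t \<in> ?U" for t
      proof -
        obtain u where u: "t < u" "ereal u < T" using time_dom_right_nbhd[of t T] t by auto
        then show ?thesis using interval_subset_time_dom[OF u(2)] t
          by (intro exI[of _ u]) (auto simp: time_dom_def subset_eq)
      qed
    qed (use elim in auto)
    then show ?case by (simp add: time_dom_def)
  qed
qed

text \<open>Logarithm of the exponential martingale with parameter \<open>\<theta>\<close> built on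
  \<open>N - \<alpha> * energy\<close>, whose bracket is \<open>energy\<close>; it is the
  continuous-time counterpart of \<open>log_exp_mart\<close>.\<close>

definition tilt :: "real \<Rightarrow> real \<Rightarrow> 'a \<Rightarrow> real" where
  "tilt \<theta> t \<omega> = \<theta> * (N t \<omega> - \<alpha> * energy t \<omega>) - \<theta>\<^sup>2 / 2 * energy t \<omega>"

lemma tilt_cont: "\<omega> \<in> space M \<Longrightarrow> continuous_on {t\<in>time_dom T. 0 < t} (\<lambda>t. tilt \<theta> t \<omega>)"
  unfolding tilt_def
  by (intro continuous_intros N_cont continuous_on_subset[OF energy_cont]) auto

lemma tilt_meas:
  assumes "0 < t" "ereal t < T"
  shows "tilt \<theta> t \<in> borel_measurable M"
proof -
  note [measurable] = N_meas[OF assms] energy_meas[OF assms]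
  show ?thesis unfolding tilt_def by measurable
qed

text \<open>For almost every outcome in \<open>F\<close> the approximating discrete exponentials
  exceed the level from some refinement on, so the discrete bound survives. One refinement has to
  serve all \<open>m\<close> times, since the discrete inequality controls the maximum along a
  single grid.\<close>

lemma tilt_maximal_grid:
  fixes x \<theta> :: real
  assumes t: "0 < t" "ereal t < T" and m: "0 < m"
  defines "F \<equiv> {\<omega> \<in> space M. \<exists>i\<in>{1..m}. x < tilt \<theta> (grid t m i) \<omega>}"
  shows "F \<in> sets M" "emeasure M F \<le> ennreal (exp (- x))"
proof -
  have \<tau>: "0 < grid t m i" "ereal (grid t m i) < T" if "i \<in> {1..m}" for i
  proof -
    show "0 < grid t m i" using that t by (simp add: grid_def)
    show "ereal (grid t m i) < T"
      using that t(2) grid_le[OF t(1), of i m] by (auto intro: le_less_trans[of _ "ereal t"])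
  qed
  have "F = (\<Union>i\<in>{1..m}. {\<omega> \<in> space M. x < tilt \<theta> (grid t m i) \<omega>})" by (auto simp: F_def)
  also have "\<dots> \<in> sets M"
    by (intro sets.finite_UN finite_atLeastAtMost borel_measurable_less borel_measurable_const tilt_meas \<tau>)
  finally show "F \<in> sets M" .
  \<comment> \<open>Using \<open>i * r\<close> cells up to \<open>grid t m i\<close> gives every
    \<open>i\<close> the same mesh \<open>t / (m * r)\<close>.\<close>
  let ?Z = "\<lambda>i r. riemann_sum (\<lambda>s \<omega>. g s * X s \<omega>) X (grid t m i) (i * r)"
  have "\<exists>r. strict_mono r \<and> (AE \<omega> in M. \<forall>i\<in>{1..m}. (\<lambda>n. ?Z i (r n) \<omega>) \<longlonglongrightarrow> N (grid t m i) \<omega>)"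
  proof (rule conv_in_prob_finite_AE_subseq[OF prob_space_axioms])
    fix i assume i: "i \<in> {1..m}"
    have "filterlim (\<lambda>r. i * r) at_top sequentially"
      using i by (intro filterlim_subseq) (auto simp: strict_mono_def)
    from conv_in_prob_compose[OF N_conv[OF \<tau>[OF i]] this]
    show "conv_in_prob M (?Z i) (N (grid t m i))" .
  qed simp
  then obtain r where r: "strict_mono r"
    "AE \<omega> in M. \<forall>i\<in>{1..m}. (\<lambda>n. ?Z i (r n) \<omega>) \<longlonglongrightarrow> N (grid t m i) \<omega>" by blast
  \<comment> \<open>The shift rules out \<open>r 0 = 0\<close>, for which the refined grid would be
    empty.\<close>
  define \<rho> where "\<rho> n = r (Suc n)" for n
  have \<rho>: "strict_mono \<rho>" "0 < \<rho> n" for n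
    using r(1) strict_mono_imp_increasing[OF r(1), of "Suc n"] by (auto simp: \<rho>_def strict_mono_def)
  define h where "h n k w = \<theta> * g (grid t n k) * \<sigma> (grid t n k) * euler \<alpha> b \<sigma> t n k w" for n k w
  define A where "A n = {\<omega> \<in> space M. \<exists>j\<le>m * \<rho> n. x < log_exp_mart (t / real (m * \<rho> n)) (h (m * \<rho> n)) j
             (\<lambda>i. B (grid t (m * \<rho> n) (Suc i)) \<omega> - B (grid t (m * \<rho> n) i) \<omega>)}" for n
  have A: "A n \<in> sets M" "emeasure M (A n) \<le> ennreal (exp (- x))" for n
  proof -
    have hm: "h (m * \<rho> n) k \<in> borel_measurable (PiM {..<n'} (\<lambda>_. borel))" if "k \<le> n'" for k n'
      unfolding h_def by (intro borel_measurable_times borel_measurable_const euler_measurable[OF that])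
    have hd: "h (m * \<rho> n) k w = h (m * \<rho> n) k w'" if "\<And>j. j < k \<Longrightarrow> w j = w' j" for k w w'
      unfolding h_def using euler_cong[of k w w', OF that] by simp
    have pos: "0 < m * \<rho> n" using m \<rho>(2)[of n] by simp
    show "A n \<in> sets M" "emeasure M (A n) \<le> ennreal (exp (- x))"
      unfolding A_def by (rule wiener_exp_mart_maximal[OF wiener t pos hm hd], assumption, assumption)+
  qed
  have "AE \<omega> in M. \<omega> \<in> F \<longrightarrow> (\<forall>\<^sub>F n in sequentially. \<omega> \<in> A n)"
    using r(2) AE_sde_path AE_space
  proof eventually_elim
    case (elim \<omega>)
    show ?case
    proof
      assume "\<omega> \<in> F"
      then obtain i where i: "i \<in> {1..m}" "x < tilt \<theta> (grid t m i) \<omega>" by (auto simp: F_def)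
      let ?\<tau> = "grid t m i"
      note \<tau>i = \<tau>[OF i(1)]
      have i0: "0 < i" using i(1) by simp
      interpret P: sde_path ?\<tau> \<alpha> b \<sigma> \<sigma>' g g' "\<lambda>s. B s \<omega>" "\<lambda>s. X s \<omega>"
        using elim(2) \<tau>i by blast
      let ?n = "\<lambda>n. i * \<rho> n"
      have sub: "strict_mono ?n" using \<rho>(1) i0 by (simp add: strict_mono_def)
      let ?S = "\<lambda>n. \<Sum>k<n. g (grid ?\<tau> n k) * \<sigma> (grid ?\<tau> n k) * P.xe n k * P.incr n k"
      let ?E = "\<lambda>n. \<Sum>k<n. (g (grid ?\<tau> n k) * \<sigma> (grid ?\<tau> n k) * P.xe n k)\<^sup>2 * (?\<tau> / real n)"
      have gb: "integral {0..?\<tau>} (\<lambda>s. g s * b s * (X s \<omega>)\<^sup>2) = energy ?\<tau> \<omega>"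
        unfolding energy_def
      proof (rule integral_cong)
        fix s assume "s \<in> {0..?\<tau>}"
        then have "s \<in> time_dom T" using interval_subset_time_dom[OF \<tau>i(2)] by blast
        from b_eq[OF this] show "g s * b s * (X s \<omega>)\<^sup>2 = (g s * \<sigma> s * X s \<omega>)\<^sup>2"
          by (simp add: power2_eq_square)
      qed
      have Z: "(\<lambda>n. riemann_sum (\<lambda>s \<omega>. g s * X s \<omega>) X ?\<tau> (?n n) \<omega>) \<longlonglongrightarrow> N ?\<tau> \<omega>"
        using LIMSEQ_Suc[of "\<lambda>n. ?Z i (r n) \<omega>"] elim(1) i(1) by (auto simp: \<rho>_def)
      from tendsto_diff[OF this LIMSEQ_subseq_LIMSEQ[OF P.riemann_sum_minus_euler_sum sub]]
      have S: "(\<lambda>n. ?S (?n n)) \<longlonglongrightarrow> N ?\<tau> \<omega> - \<alpha> * energy ?\<tau> \<omega>"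
        unfolding gb riemann_sum_grid by (simp add: comp_def)
      have E: "(\<lambda>n. ?E (?n n)) \<longlonglongrightarrow> energy ?\<tau> \<omega>"
        using LIMSEQ_subseq_LIMSEQ[OF P.euler_energy sub] unfolding energy_def by (simp add: comp_def)
      let ?L = "\<lambda>n. log_exp_mart (t / real (m * \<rho> n)) (h (m * \<rho> n)) (?n n)
             (\<lambda>i. B (grid t (m * \<rho> n) (Suc i)) \<omega> - B (grid t (m * \<rho> n) i) \<omega>)"
      \<comment> \<open>Index \<open>i * \<rho> n\<close> of the grid on \<open>[0, t]\<close> is
        the time \<open>grid t m i\<close>, so the partial sum up to it is the full sum on the
        shorter interval.\<close>
      have "?L n = \<theta> * ?S (?n n) - \<theta>\<^sup>2 / 2 * ?E (?n n)" for n
      proof -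
        have d: "?\<tau> / real (?n n) = t / real (m * \<rho> n)" using i0 by (simp add: grid_def)
        show ?thesis
          unfolding log_exp_mart_def h_def sum_distrib_left sum_subtractf[symmetric] d
            grid_refine[OF i0] euler_refine[OF i0]
          by (intro sum.cong refl) (simp add: power2_eq_square mult_ac)
      qed
      moreover have "(\<lambda>n. \<theta> * ?S (?n n) - \<theta>\<^sup>2 / 2 * ?E (?n n)) \<longlonglongrightarrow> tilt \<theta> ?\<tau> \<omega>"
        unfolding tilt_def by (intro tendsto_intros S E)
      ultimately have "?L \<longlonglongrightarrow> tilt \<theta> ?\<tau> \<omega>" by simp
      \<comment> \<open>The strict inequality in \<open>F\<close> is an open condition, hence holds
        for all late approximants.\<close>
      from order_tendstoD(1)[OF this i(2)]
      show "\<forall>\<^sub>F n in sequentially. \<omega> \<in> A n"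
      proof eventually_elim
        case (elim n)
        moreover have "?n n \<le> m * \<rho> n" using i(1) by simp
        ultimately show ?case unfolding A_def using \<open>\<omega> \<in> space M\<close> by blast
      qed
    qed
  qed
  from emeasure_le_eventually[OF A this] show "emeasure M F \<le> ennreal (exp (- x))" .
qed

text \<open>Dyadic grids are nested, so the events increase and the bound, uniform in the grid,
  passes to their union. Continuity of \<open>tilt\<close> shows that the union misses no
  time.\<close>

lemma tilt_maximal_upto:
  fixes x \<theta> :: real
  assumes t: "0 < t" "ereal t < T"
  defines "G \<equiv> {\<omega> \<in> space M. \<exists>s\<in>{0<..t}. x < tilt \<theta> s \<omega>}"
  shows "G \<in> sets M" "emeasure M G \<le> ennreal (exp (- x))"
proof -
  define F where "F j = {\<omega> \<in> space M. \<exists>i\<in>{1..2 ^ j}. x < tilt \<theta> (grid t (2 ^ j) i) \<omega>}" for j :: nat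
  have F: "F j \<in> sets M" "emeasure M (F j) \<le> ennreal (exp (- x))" for j
    unfolding F_def by (rule tilt_maximal_grid[OF t]; simp)+
  have inc: "incseq F"
  proof (rule incseq_SucI, rule subsetI)
    fix j \<omega> assume "\<omega> \<in> F j"
    then obtain i where i: "\<omega> \<in> space M" "i \<in> {1..2 ^ j}" "x < tilt \<theta> (grid t (2 ^ j) i) \<omega>"
      by (auto simp: F_def)
    moreover have "grid t (2 ^ j) i = grid t (2 ^ Suc j) (2 * i)" by (simp add: grid_def)
    ultimately show "\<omega> \<in> F (Suc j)"
      unfolding F_def by (auto intro!: bexI[of _ "2 * i"])
  qed
  have "G = (\<Union>j. F j)"
  proof (intro equalityI subsetI)
    fix \<omega> assume "\<omega> \<in> (\<Union>j. F j)"
    then obtain j i where i: "\<omega> \<in> space M" "i \<in> {1..2 ^ j}" "x < tilt \<theta> (grid t (2 ^ j) i) \<omega>"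
      by (auto simp: F_def)
    have "grid t (2 ^ j) i \<in> {0<..t}"
      using i(2) t(1) grid_le[OF t(1), of i "2 ^ j"] by (simp add: grid_def)
    then show "\<omega> \<in> G" using i by (auto simp: G_def)
  next
    fix \<omega> assume "\<omega> \<in> G"
    then obtain s where s: "\<omega> \<in> space M" "0 < s" "s \<le> t" "x < tilt \<theta> s \<omega>" by (auto simp: G_def)
    \<comment> \<open>Rounding up approximates \<open>s\<close> from the right and keeps the index
      between 1 and \<open>2 ^ j\<close>, away from time 0.\<close>
    define i where "i j = nat \<lceil>s / t * 2 ^ j\<rceil>" for j :: nat
    have pos: "0 < s / t * 2 ^ j" for j using s t by simp
    have i: "s / t * 2 ^ j \<le> real (i j)" "real (i j) < s / t * 2 ^ j + 1" for j
      using pos[of j] unfolding i_def by linarith+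
    have "real (i j) < 2 ^ j + 1" for j
    proof -
      have "s / t * 2 ^ j \<le> 1 * 2 ^ j" using s t by (intro mult_right_mono) auto
      then show ?thesis using i(2)[of j] by simp
    qed
    then have "real (i j) < real (2 ^ j + 1)" for j by (simp add: add.commute)
    then have ile: "i j \<le> 2 ^ j" for j by (metis less_Suc_eq_le Suc_eq_plus1 of_nat_less_iff)
    have i1: "1 \<le> i j" for j using i(1)[of j] pos[of j] by linarith
    let ?q = "\<lambda>j. grid t (2 ^ j) (i j)"
    have "(\<lambda>j. t * (1 / 2) ^ j) \<longlonglongrightarrow> t * 0"
      by (intro tendsto_intros LIMSEQ_realpow_zero) auto
    then have lim0: "(\<lambda>j. s + t * (1 / 2) ^ j) \<longlonglongrightarrow> s"
      using tendsto_add[OF tendsto_const[of s]] by fastforce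
    have qb: "s \<le> ?q j" "?q j \<le> s + t * (1 / 2) ^ j" for j
    proof -
      have "t * (s / t * 2 ^ j) \<le> t * real (i j)" using i(1)[of j] t by (intro mult_left_mono) auto
      then show "s \<le> ?q j" using t by (simp add: grid_def field_simps)
      have "t * real (i j) \<le> t * (s / t * 2 ^ j + 1)" using i(2)[of j] t by (intro mult_left_mono) auto
      then have "t * real (i j) \<le> s * 2 ^ j + t" using t by (simp add: distrib_left)
      then show "?q j \<le> s + t * (1 / 2) ^ j" using t by (simp add: grid_def field_simps)
    qed
    have lim: "?q \<longlonglongrightarrow> s"
      by (rule tendsto_sandwich[OF _ _ tendsto_const lim0]) (use qb in auto)
    have U: "?q j \<in> {t\<in>time_dom T. 0 < t}" for j
      using grid_mem[OF t(1) ile[of j]] interval_subset_time_dom[OF t(2)] qb(1)[of j] s(2) by auto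
    have sU: "s \<in> {t\<in>time_dom T. 0 < t}"
      using s interval_subset_time_dom[OF t(2)] by auto
    have "(\<lambda>j. tilt \<theta> (?q j) \<omega>) \<longlonglongrightarrow> tilt \<theta> s \<omega>"
      using tilt_cont[OF s(1), of \<theta>, unfolded continuous_on_sequentially, rule_format, of s ?q] lim U sU
      by (simp add: comp_def)
    from order_tendstoD(1)[OF this s(4)]
    obtain j where "x < tilt \<theta> (?q j) \<omega>" by (auto simp: eventually_sequentially)
    then have "\<omega> \<in> F j" unfolding F_def using s(1) ile[of j] i1[of j] by auto
    then show "\<omega> \<in> (\<Union>j. F j)" by blast
  qed
  with emeasure_UN_incseq_le[OF F(1) inc F(2)]
  show "G \<in> sets M" "emeasure M G \<le> ennreal (exp (- x))" by auto
qed

text \<open>The bound \<open>exp (- x)\<close> does not depend on the horizon and so holds up to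
  \<open>T\<close>; letting \<open>x\<close> run through the naturals leaves a null set of paths
  unbounded above.\<close>

lemma AE_tilt_bounded:
  "AE \<omega> in M. \<exists>C. \<forall>s. 0 < s \<longrightarrow> ereal s < T \<longrightarrow> tilt \<theta> s \<omega> \<le> C"
proof -
  obtain \<tau> :: "nat \<Rightarrow> real" where \<tau>: "incseq \<tau>" "\<And>i. 0 < ereal (\<tau> i)" "\<And>i. ereal (\<tau> i) < T"
    "(\<lambda>i. ereal (\<tau> i)) \<longlonglongrightarrow> T"
    using ereal_incseq_approx[OF T] by metis
  define G where "G x = {\<omega> \<in> space M. \<exists>s. 0 < s \<and> ereal s < T \<and> x < tilt \<theta> s \<omega>}" for x
  define G' where "G' x j = {\<omega> \<in> space M. \<exists>s\<in>{0<..\<tau> j}. x < tilt \<theta> s \<omega>}" for x j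
  have G': "G' x j \<in> sets M" "emeasure M (G' x j) \<le> ennreal (exp (- x))" for x j
    unfolding G'_def using \<tau>(2,3)[of j] by (auto intro!: tilt_maximal_upto)
  have inc: "incseq (G' x)" for x
    using \<tau>(1) by (fastforce simp: incseq_def G'_def)
  have GU: "G x = (\<Union>j. G' x j)" for x
  proof (intro equalityI subsetI)
    fix \<omega> assume "\<omega> \<in> (\<Union>j. G' x j)"
    then obtain j s where "\<omega> \<in> space M" "0 < s" "s \<le> \<tau> j" "x < tilt \<theta> s \<omega>" by (auto simp: G'_def)
    moreover from this have "ereal s < T" using \<tau>(3)[of j] by (auto intro: le_less_trans[of _ "ereal (\<tau> j)"])
    ultimately show "\<omega> \<in> G x" by (auto simp: G_def)
  next
    fix \<omega> assume "\<omega> \<in> G x"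
    then obtain s where s: "\<omega> \<in> space M" "0 < s" "ereal s < T" "x < tilt \<theta> s \<omega>" by (auto simp: G_def)
    from order_tendstoD(1)[OF \<tau>(4) s(3)] obtain j where "s < \<tau> j" by (auto simp: eventually_sequentially)
    then show "\<omega> \<in> (\<Union>j. G' x j)" using s by (auto simp: G'_def intro!: exI[of _ j] bexI[of _ s])
  qed
  have G: "G x \<in> sets M" "emeasure M (G x) \<le> ennreal (exp (- x))" for x
    using emeasure_UN_incseq_le[OF G'(1) inc G'(2)] by (auto simp: GU)
  let ?H = "\<Inter>n::nat. G (real n)"
  have H: "?H \<in> sets M" using G(1) by blast
  have "emeasure M ?H \<le> ennreal (exp (- real n))" for n
    using emeasure_mono[of ?H "G (real n)" M] G[of "real n"] by (meson INF_lower UNIV_I order_trans)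
  moreover have "(\<lambda>n. ennreal (exp (- real n))) \<longlonglongrightarrow> ennreal 0"
    by (intro tendsto_ennrealI filterlim_compose[OF exp_at_bot] filterlim_compose[OF filterlim_uminus_at_bot_at_top]
        filterlim_real_sequentially)
  ultimately have "emeasure M ?H \<le> ennreal 0"
    by (intro LIMSEQ_le_const) auto
  then have "?H \<in> null_sets M" using H by (auto simp: null_sets_def)
  from AE_not_in[OF this] AE_space show ?thesis
  proof eventually_elim
    case (elim \<omega>)
    then obtain n where "\<omega> \<notin> G (real n)" by auto
    then show ?case using elim(2) unfolding G_def by (intro exI[of _ "real n"]) (blast intro: leI)
  qed
qed

end

section \<open>Divergence of the energy and consistency\<close>

lemma eventually_time_limit:
  assumes "t0 \<in> time_dom T"
  shows "\<forall>\<^sub>F t in time_limit T. t0 < t \<and> ereal t < T"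
proof (cases T)
  case PInf
  then show ?thesis using eventually_gt_at_top[of t0] by (simp add: time_limit_def)
next
  case (real r)
  then have "t0 < r" using assms by (simp add: time_dom_def)
  then have "\<forall>\<^sub>F t in at_left r. t \<in> {t0<..<r}" by (rule eventually_at_left_real)
  then show ?thesis using real by (simp add: time_limit_def)
qed (use assms in \<open>auto simp: time_dom_def\<close>)

text \<open>\<open>S\<close> stands for the tail integral of \<open>\<sigma>\<^sup>2\<close>.
  Differentiating \<open>g = - 1 / (2 * K * S)\<close> gives the Riccati equation
  \<open>g'_eq\<close>, which makes the integral of \<open>X\<^sup>2 * g'\<close> in Ito's formula a
  multiple of the energy. \<open>S_small\<close> is the source of the divergence of the
  clock.\<close>

locale bridge_sde = linear_sde +
  fixes K :: real and S :: "real \<Rightarrow> real"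
  assumes K: "K \<noteq> 0"
    and S_pos: "\<And>s. s \<in> time_dom T \<Longrightarrow> 0 < S s"
    and S_deriv: "\<And>s. s \<in> time_dom T \<Longrightarrow> (S has_real_derivative - (\<sigma> s)\<^sup>2) (at s within time_dom T)"
    and S_small: "\<And>\<epsilon>. 0 < \<epsilon> \<Longrightarrow> \<exists>s\<in>time_dom T. S s < \<epsilon>"
    and g_eq: "\<And>s. s \<in> time_dom T \<Longrightarrow> g s = - 1 / (2 * K * S s)"
    and g'_eq: "\<And>s. s \<in> time_dom T \<Longrightarrow> g' s = - 2 * K * (g s * \<sigma> s)\<^sup>2"
begin

text \<open>The intrinsic time of the problem: in the time scale \<open>clock\<close> the process
  \<open>X / sqrt S\<close> is an Ornstein--Uhlenbeck process.\<close>

definition clock :: "real \<Rightarrow> real" where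
  "clock t = ln (S 0) - ln (S t)"

lemma zero_mem: "0 \<in> time_dom T"
  using T by (simp add: time_dom_def zero_ereal_def)

lemma clock_deriv:
  assumes "s \<in> time_dom T"
  shows "(clock has_real_derivative (\<sigma> s)\<^sup>2 / S s) (at s within time_dom T)"
  unfolding clock_def using S_pos[OF assms]
  by (auto intro!: derivative_eq_intros S_deriv[OF assms])

lemma clock_0 [simp]: "clock 0 = 0"
  by (simp add: clock_def)

lemma clock_unbounded: "\<exists>s\<in>time_dom T. C < clock s"
proof -
  have S0: "0 < S 0" by (rule S_pos[OF zero_mem])
  obtain s where s: "s \<in> time_dom T" "S s < S 0 * exp (- C)"
    using S_small[of "S 0 * exp (- C)"] S0 by auto
  then have "ln (S s) < ln (S 0 * exp (- C))"
    using S_pos[OF s(1)] S0 by simp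
  then have "C < clock s" using S0 by (simp add: clock_def ln_mult)
  then show ?thesis using s(1) by blast
qed

lemma ftc_time_dom:
  assumes "t \<in> time_dom T"
    and "\<And>s. s \<in> time_dom T \<Longrightarrow> (F has_real_derivative f s) (at s within time_dom T)"
  shows "(f has_integral F t - F 0) {0..t}"
proof (rule fundamental_theorem_of_calculus)
  have tT: "0 \<le> t" "ereal t < T" using assms(1) by (auto simp: time_dom_def)
  note sub = interval_subset_time_dom[OF tT(2)]
  show "0 \<le> t" by fact
  show "(F has_vector_derivative f s) (at s within {0..t})" if "s \<in> {0..t}" for s
    using DERIV_subset[OF assms(2) sub] that sub
    by (auto simp: has_real_derivative_iff_has_vector_derivative[symmetric])
qed

lemma integral_b: "t \<in> time_dom T \<Longrightarrow> integral {0..t} b = - clock t / (2 * K)"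
proof -
  assume t: "t \<in> time_dom T"
  have "(b has_integral - clock t / (2 * K) - - clock 0 / (2 * K)) {0..t}"
  proof (rule ftc_time_dom[OF t])
    fix s assume s: "s \<in> time_dom T"
    have "b s = - ((\<sigma> s)\<^sup>2 / S s) / (2 * K)"
      using b_eq[OF s] g_eq[OF s] K by (simp add: field_simps)
    then show "((\<lambda>t. - clock t / (2 * K)) has_real_derivative b s) (at s within time_dom T)"
      by (auto intro!: derivative_eq_intros clock_deriv[OF s] simp: K)
  qed
  then show ?thesis by (simp add: integral_unique)
qed

lemma integrand_cont: "\<omega> \<in> space M \<Longrightarrow> continuous_on (time_dom T) (\<lambda>s. (g s * \<sigma> s * X s \<omega>)\<^sup>2)"
  by (intro continuous_intros g_cont \<sigma>_cont X_cont)

lemma integrand_integrable: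
  "\<omega> \<in> space M \<Longrightarrow> ereal t < T \<Longrightarrow> (\<lambda>s. (g s * \<sigma> s * X s \<omega>)\<^sup>2) integrable_on {0..t}"
  by (intro integrable_continuous_real continuous_on_subset[OF integrand_cont] interval_subset_time_dom)

lemma energy_mono:
  assumes "\<omega> \<in> space M" "s \<le> t" "ereal t < T"
  shows "energy s \<omega> \<le> energy t \<omega>"
proof -
  have "ereal s < T" using assms by (auto intro: le_less_trans[of _ "ereal t"])
  then show ?thesis
    unfolding energy_def using assms
    by (intro integral_subset_le integrand_integrable) auto
qed

text \<open>Ito's formula multiplied by \<open>- 4 * K\<close>, with
  \<open>- 2 * K * g = 1 / S\<close>, \<open>g'_eq\<close> and \<open>integral_b\<close>
  inserted.\<close>

lemma ito_clock:
  assumes t: "t \<in> time_dom T"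
    and N: "N t \<omega> = (g t * (X t \<omega>)\<^sup>2 - integral {0..t} (\<lambda>s. (X s \<omega>)\<^sup>2 * g' s) - integral {0..t} b) / 2"
  shows "(X t \<omega>)\<^sup>2 / S t = clock t + 4 * K\<^sup>2 * energy t \<omega> - 4 * K * N t \<omega>"
proof -
  have "integral {0..t} (\<lambda>s. (X s \<omega>)\<^sup>2 * g' s) = integral {0..t} (\<lambda>s. (- 2 * K) * (g s * \<sigma> s * X s \<omega>)\<^sup>2)"
  proof (rule integral_cong)
    fix s assume "s \<in> {0..t}"
    then have "s \<in> time_dom T" using t interval_subset_time_dom[of t T] by (auto simp: time_dom_def)
    from g'_eq[OF this] show "(X s \<omega>)\<^sup>2 * g' s = (- 2 * K) * (g s * \<sigma> s * X s \<omega>)\<^sup>2"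
      by (simp add: power_mult_distrib)
  qed
  then have "integral {0..t} (\<lambda>s. (X s \<omega>)\<^sup>2 * g' s) = - 2 * K * energy t \<omega>"
    unfolding energy_def by simp
  then show ?thesis
    using N integral_b[OF t] g_eq[OF t] S_pos[OF t] K
    by (simp add: field_simps power2_eq_square)
qed

lemma energy_unbounded:
  assumes \<omega>: "\<omega> \<in> space M"
    and ito: "\<And>t. 0 < t \<Longrightarrow> ereal t < T \<Longrightarrow>
      N t \<omega> = (g t * (X t \<omega>)\<^sup>2 - integral {0..t} (\<lambda>s. (X s \<omega>)\<^sup>2 * g' s) - integral {0..t} b) / 2"
    and up: "\<And>t. 0 < t \<Longrightarrow> ereal t < T \<Longrightarrow> tilt 1 t \<omega> \<le> C"
    and down: "\<And>t. 0 < t \<Longrightarrow> ereal t < T \<Longrightarrow> tilt (- 1) t \<omega> \<le> C"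
  shows "\<exists>t\<in>time_dom T. 0 < t \<and> R < energy t \<omega>"
proof (rule ccontr)
  assume neg: "\<not> ?thesis"
  have E0: "0 \<le> energy t \<omega>" if "ereal t < T" for t
    unfolding energy_def by (intro integral_nonneg integrand_integrable \<omega> that) auto
  have ER: "energy t \<omega> \<le> R" if "0 < t" "ereal t < T" for t
    using neg that by (force simp: time_dom_def)
  have Nb: "\<bar>N t \<omega>\<bar> \<le> \<bar>C\<bar> + (\<bar>\<alpha>\<bar> + 1) * R" if t: "0 < t" "ereal t < T" for t
  proof -
    have E: "0 \<le> energy t \<omega>" "energy t \<omega> \<le> R" using E0 ER t by auto
    have "\<bar>N t \<omega> - \<alpha> * energy t \<omega>\<bar> \<le> \<bar>C\<bar> + R"
      using up[OF t] down[OF t] E unfolding tilt_def abs_le_iff by simp linarith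
    moreover have "\<bar>\<alpha> * energy t \<omega>\<bar> \<le> \<bar>\<alpha>\<bar> * R"
      using E unfolding abs_mult by (intro mult_left_mono) auto
    ultimately have "\<bar>N t \<omega>\<bar> \<le> \<bar>C\<bar> + R + \<bar>\<alpha>\<bar> * R" by linarith
    then show ?thesis by (simp add: algebra_simps)
  qed
  define c where "c = \<bar>4 * K * (\<bar>C\<bar> + (\<bar>\<alpha>\<bar> + 1) * R)\<bar>"
  have lower: "clock t - c \<le> (X t \<omega>)\<^sup>2 / S t" if t: "t \<in> time_dom T" for t
  \<comment> \<open>Ito's formula is available for positive times; at time 0 the claim reads
    \<open>- c \<le> 0\<close>.\<close>
  proof (cases "t = 0")
    case True
    then show ?thesis using X_0[OF \<omega>] by (simp add: c_def)
  next
    case False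
    then have t': "0 < t" "ereal t < T" using t by (auto simp: time_dom_def)
    have "\<bar>4 * K * N t \<omega>\<bar> \<le> c"
      unfolding c_def abs_mult using Nb[OF t'] by (intro mult_left_mono) auto
    moreover have "0 \<le> 4 * K\<^sup>2 * energy t \<omega>" using E0[OF t'(2)] by simp
    ultimately show ?thesis
      unfolding ito_clock[OF t ito[OF t']] by linarith
  qed
  have bound: "(clock t)\<^sup>2 / 2 - c * clock t \<le> 4 * K\<^sup>2 * R" if t: "t \<in> time_dom T" "0 < t" for t
  proof -
    have tT: "ereal t < T" using t by (simp add: time_dom_def)
    \<comment> \<open>The second factor is the derivative of the clock, so the integral has the
      closed form \<open>clock\<^sup>2 / 2 - c * clock\<close>: a quadratic in an unbounded
      quantity, dominated by the energy.\<close>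
    let ?f = "\<lambda>s. (clock s - c) * ((\<sigma> s)\<^sup>2 / S s)"
    have "(?f has_integral ((clock t)\<^sup>2 / 2 - c * clock t) - ((clock 0)\<^sup>2 / 2 - c * clock 0)) {0..t}"
      by (rule ftc_time_dom[OF t(1)])
         (auto intro!: derivative_eq_intros clock_deriv simp: algebra_simps diff_divide_distrib)
    then have "(?f has_integral (clock t)\<^sup>2 / 2 - c * clock t) {0..t}" by simp
    moreover have "((\<lambda>s. 4 * K\<^sup>2 * (g s * \<sigma> s * X s \<omega>)\<^sup>2) has_integral 4 * K\<^sup>2 * energy t \<omega>) {0..t}"
      unfolding energy_def by (intro has_integral_mult_right integrable_integral integrand_integrable \<omega> tT)
    moreover have "?f s \<le> 4 * K\<^sup>2 * (g s * \<sigma> s * X s \<omega>)\<^sup>2" if "s \<in> {0..t}" for s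
    proof -
      have s: "s \<in> time_dom T" using that interval_subset_time_dom[OF tT] by blast
      have "?f s \<le> (X s \<omega>)\<^sup>2 / S s * ((\<sigma> s)\<^sup>2 / S s)"
        using lower[OF s] S_pos[OF s] by (intro mult_right_mono) auto
      also have "\<dots> = 4 * K\<^sup>2 * (g s * \<sigma> s * X s \<omega>)\<^sup>2"
        using S_pos[OF s] K by (simp add: g_eq[OF s] power2_eq_square field_simps)
      finally show ?thesis .
    qed
    ultimately have "(clock t)\<^sup>2 / 2 - c * clock t \<le> 4 * K\<^sup>2 * energy t \<omega>"
      by (rule has_integral_le)
    also have "\<dots> \<le> 4 * K\<^sup>2 * R" using ER[OF t(2) tT] by (intro mult_left_mono) auto
    finally show ?thesis .
  qed
  have c0: "0 \<le> c" by (simp add: c_def)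
  \<comment> \<open>The threshold makes \<open>clock t / 2 - c\<close> exceed 1, so the quadratic is
    at least \<open>clock t\<close>, which is larger than \<open>4 * K\<^sup>2 * R\<close>.\<close>
  obtain t where t: "t \<in> time_dom T" "2 * c + 2 + \<bar>4 * K\<^sup>2 * R\<bar> < clock t"
    using clock_unbounded by blast
  have "t \<noteq> 0" using t(2) c0 by auto
  then have "0 < t" using t(1) by (simp add: time_dom_def)
  have "clock t * 1 \<le> clock t * (clock t / 2 - c)"
    using t(2) c0 by (intro mult_left_mono) auto
  also have "\<dots> \<le> 4 * K\<^sup>2 * R"
    using bound[OF t(1) \<open>0 < t\<close>] by (simp add: power2_eq_square algebra_simps)
  finally show False using t(2) c0 by linarith
qed

text \<open>The parameters \<open>1 / Suc m\<close> form a countable family, so the null sets of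
  \<open>AE_tilt_bounded\<close> can be united, and they still fall below every tolerance.\<close>

lemma estimator_tendsto:
  assumes \<omega>: "\<omega> \<in> space M"
    and ito: "\<And>t. 0 < t \<Longrightarrow> ereal t < T \<Longrightarrow>
      N t \<omega> = (g t * (X t \<omega>)\<^sup>2 - integral {0..t} (\<lambda>s. (X s \<omega>)\<^sup>2 * g' s) - integral {0..t} b) / 2"
    and bdd: "\<And>m::nat. \<exists>C. \<forall>t. 0 < t \<longrightarrow> ereal t < T \<longrightarrow>
        tilt (1 / real (Suc m)) t \<omega> \<le> C \<and> tilt (- (1 / real (Suc m))) t \<omega> \<le> C"
  shows "((\<lambda>t. N t \<omega> / energy t \<omega>) \<longlongrightarrow> \<alpha>) (time_limit T)"
proof (rule tendstoI)
  fix e :: real assume e: "0 < e"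
  obtain m :: nat where m: "1 / real (Suc m) < e"
    using e nat_approx_posE by blast
  define \<theta> where "\<theta> = 1 / real (Suc m)"
  have \<theta>: "0 < \<theta>" "\<theta> < e" using m by (auto simp: \<theta>_def)
  obtain C where C: "\<And>t. 0 < t \<Longrightarrow> ereal t < T \<Longrightarrow> tilt \<theta> t \<omega> \<le> C"
      "\<And>t. 0 < t \<Longrightarrow> ereal t < T \<Longrightarrow> tilt (- \<theta>) t \<omega> \<le> C"
    using bdd[of m] unfolding \<theta>_def by blast
  \<comment> \<open>\<open>m = 0\<close> is \<open>\<theta> = 1\<close>, the pair of bounds that
    \<open>energy_unbounded\<close> asks for.\<close>
  obtain C1 where C1: "\<And>t. 0 < t \<Longrightarrow> ereal t < T \<Longrightarrow> tilt 1 t \<omega> \<le> C1"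
      "\<And>t. 0 < t \<Longrightarrow> ereal t < T \<Longrightarrow> tilt (- 1) t \<omega> \<le> C1"
    using bdd[of 0] by auto
  \<comment> \<open>Beyond \<open>R\<close> the constant \<open>|C|\<close> is less than
    \<open>\<theta>\<^sup>2 / 2 * energy\<close>; together with the equal compensator term the total
    stays below \<open>\<theta>\<^sup>2 * energy\<close>.\<close>
  define R where "R = 2 * \<bar>C\<bar> / \<theta>\<^sup>2"
  obtain t0 where t0: "t0 \<in> time_dom T" "0 < t0" "R < energy t0 \<omega>"
    using energy_unbounded[OF \<omega> ito C1] by blast
  from eventually_time_limit[OF t0(1)]
  show "\<forall>\<^sub>F t in time_limit T. dist (N t \<omega> / energy t \<omega>) \<alpha> < e"
  proof eventually_elim
    case (elim t)
    then have t: "0 < t" "ereal t < T" using t0 by auto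
    have E: "R < energy t \<omega>" using energy_mono[OF \<omega>, of t0 t] elim t0 by auto
    have E0: "0 < energy t \<omega>" using E by (smt (verit) R_def divide_nonneg_nonneg zero_le_power2)
    let ?M = "N t \<omega> - \<alpha> * energy t \<omega>"
    have "\<theta> * \<bar>?M\<bar> \<le> \<bar>C\<bar> + \<theta>\<^sup>2 / 2 * energy t \<omega>"
      using C[OF t] unfolding tilt_def by (cases "0 \<le> ?M") (auto simp: algebra_simps)
    also have "\<bar>C\<bar> < \<theta>\<^sup>2 / 2 * energy t \<omega>"
      using E \<theta>(1) by (simp add: R_def field_simps)
    finally have "\<theta> * \<bar>?M\<bar> < \<theta> * (\<theta> * energy t \<omega>)"
      by (simp add: power2_eq_square algebra_simps)
    then have "\<bar>?M\<bar> < \<theta> * energy t \<omega>" using \<theta>(1) by simp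
    then have "\<bar>?M\<bar> / energy t \<omega> < \<theta>" using E0 by (simp add: field_simps)
    moreover have "N t \<omega> / energy t \<omega> - \<alpha> = ?M / energy t \<omega>"
      using E0 by (simp add: diff_divide_distrib)
    ultimately show ?case using \<theta>(2) E0 by (simp add: dist_real_def)
  qed
qed

lemma AE_estimator_tendsto:
  "AE \<omega> in M. ((\<lambda>t. N t \<omega> / energy t \<omega>) \<longlongrightarrow> \<alpha>) (time_limit T)"
proof -
  have "AE \<omega> in M. \<forall>m. (\<exists>C. \<forall>t. 0 < t \<longrightarrow> ereal t < T \<longrightarrow> tilt (1 / real (Suc m)) t \<omega> \<le> C)
      \<and> (\<exists>C. \<forall>t. 0 < t \<longrightarrow> ereal t < T \<longrightarrow> tilt (- (1 / real (Suc m))) t \<omega> \<le> C)"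
    by (subst AE_all_countable, intro allI AE_conjI AE_tilt_bounded)
  then show ?thesis using AE_ito AE_space
  proof eventually_elim
    case (elim \<omega>)
    show ?case
    proof (rule estimator_tendsto[OF elim(3)])
      fix m :: nat
      obtain C C' where "\<forall>t. 0 < t \<longrightarrow> ereal t < T \<longrightarrow> tilt (1 / real (Suc m)) t \<omega> \<le> C"
        "\<forall>t. 0 < t \<longrightarrow> ereal t < T \<longrightarrow> tilt (- (1 / real (Suc m))) t \<omega> \<le> C'"
        using elim(1) by blast
      then show "\<exists>C. \<forall>t. 0 < t \<longrightarrow> ereal t < T \<longrightarrow>
        tilt (1 / real (Suc m)) t \<omega> \<le> C \<and> tilt (- (1 / real (Suc m))) t \<omega> \<le> C"
        by (intro exI[of _ "max C C'"]) (simp add: le_max_iff_disj)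
    qed (use elim(2) in blast)
  qed
qed

end

text \<open>The first claim splits the domain at \<open>t\<close>. The second is continuity from
  above along times increasing to \<open>T\<close>: no point of the half-open domain lies beyond all
  of them.\<close>

lemma tail_integral:
  fixes f :: "real \<Rightarrow> real"
  assumes T: "0 < T" and f: "continuous_on (time_dom T) f" and int: "set_integrable lborel (time_dom T) f"
  defines "S \<equiv> \<lambda>t. LINT s:{s\<in>time_dom T. t \<le> s}|lborel. f s"
  shows "\<And>t. t \<in> time_dom T \<Longrightarrow> S t = S 0 - integral {0..t} f"
    and "\<And>\<epsilon>. 0 < \<epsilon> \<Longrightarrow> \<exists>s\<in>time_dom T. S s < \<epsilon>"
proof -
  have meas: "{s\<in>time_dom T. t \<le> s} \<in> sets lborel" for t
  proof -
    have "Measurable.pred borel (\<lambda>s. 0 \<le> s \<and> ereal s < T \<and> t \<le> s)" by measurable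
    then show ?thesis by (simp add: time_dom_def pred_def)
  qed
  have int': "set_integrable lborel {s\<in>time_dom T. t \<le> s} f" for t
    by (rule set_integrable_subset[OF int meas]) auto
  show "S t = S 0 - integral {0..t} f" if t: "t \<in> time_dom T" for t
  proof -
    have tT: "0 \<le> t" "ereal t < T" using t by (auto simp: time_dom_def)
    note sub = interval_subset_time_dom[OF tT(2)]
    have i0: "set_integrable lborel {0..t} f"
      by (rule set_integrable_subset[OF int _ sub]) simp
    have "{s\<in>time_dom T. 0 \<le> s} = {0..t} \<union> {s\<in>time_dom T. t \<le> s}"
      using sub by (auto simp: time_dom_def)
    moreover have "(LINT s:{0..t} \<union> {s\<in>time_dom T. t \<le> s}|lborel. f s)
       = (LINT s:{0..t}|lborel. f s) + (LINT s:{s\<in>time_dom T. t \<le> s}|lborel. f s)"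
    proof (rule set_integral_Un_AE)
      \<comment> \<open>The two pieces overlap in the single point \<open>t\<close>.\<close>
      have "AE s in lborel. s \<noteq> t" by (rule AE_lborel_singleton)
      then show "AE s in lborel. \<not> (s \<in> {0..t} \<and> s \<in> {s\<in>time_dom T. t \<le> s})"
        by eventually_elim auto
    qed (use i0 int' meas in auto)
    moreover have "(LINT s:{0..t}|lborel. f s) = integral {0..t} f"
      by (rule set_borel_integral_eq_integral[OF i0])
    ultimately show ?thesis by (simp add: S_def)
  qed
  fix \<epsilon> :: real assume e: "0 < \<epsilon>"
  obtain \<tau> :: "nat \<Rightarrow> real" where \<tau>: "incseq \<tau>" "\<And>i. 0 < ereal (\<tau> i)" "\<And>i. ereal (\<tau> i) < T"
    "(\<lambda>i. ereal (\<tau> i)) \<longlonglongrightarrow> T"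
    using ereal_incseq_approx[OF T] by metis
  let ?A = "\<lambda>i. {s\<in>time_dom T. \<tau> i \<le> s}"
  have "(\<Inter>i. ?A i) = {}"
  proof (rule equals0I)
    fix s assume s: "s \<in> (\<Inter>i. ?A i)"
    then have "ereal s < T" by (auto simp: time_dom_def)
    from order_tendstoD(1)[OF \<tau>(4) this] obtain i where "s < \<tau> i" by (auto simp: eventually_sequentially)
    moreover have "\<tau> i \<le> s" using s by blast
    ultimately show False by simp
  qed
  moreover have "(\<lambda>i. LINT s:?A i|lborel. f s) \<longlonglongrightarrow> (LINT s:(\<Inter>i. ?A i)|lborel. f s)"
  proof (rule set_integral_cont_down)
    show "decseq ?A" using \<tau>(1) by (force simp: decseq_def incseq_def)
  qed (use meas int' in auto)
  ultimately have "(\<lambda>i. S (\<tau> i)) \<longlonglongrightarrow> 0"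
    by (simp add: S_def set_lebesgue_integral_def)
  from order_tendstoD(2)[OF this e] obtain i where "S (\<tau> i) < \<epsilon>" by (auto simp: eventually_sequentially)
  then show "\<exists>s\<in>time_dom T. S s < \<epsilon>"
    using \<tau>(2,3)[of i] by (intro bexI[of _ "\<tau> i"]) (auto simp: time_dom_def)
qed

theorem mainTheorem10:
  fixes M :: "'a measure" and T :: ereal and b \<sigma> :: "real \<Rightarrow> real" and K \<alpha> :: real
    and B X N :: "real \<Rightarrow> 'a \<Rightarrow> real"
  assumes "0 < T"
    and "C1_on (time_dom T) b" and "C1_on (time_dom T) \<sigma>"
    and "\<forall>t\<in>time_dom T. b t \<noteq> 0" and "\<forall>t\<in>time_dom T. 0 < \<sigma> t"
    and "wiener_process M T B"
    and "set_integrable lborel (time_dom T) (\<lambda>s. (\<sigma> s)\<^sup>2)"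
    and "K \<noteq> 0"
    and "\<forall>t\<in>time_dom T. b t = (\<sigma> t)\<^sup>2 /
           (- 2 * K * (LINT s:{s\<in>time_dom T. t \<le> s}|lborel. (\<sigma> s)\<^sup>2))"
    and "strong_solution M T \<alpha> b \<sigma> B X"
    and "\<forall>t\<in>time_dom T. 0 < t \<longrightarrow>
           stoch_integral M (\<lambda>s \<omega>. b s / (\<sigma> s)\<^sup>2 * X s \<omega>) X t (N t)"
    and "\<forall>\<omega>\<in>space M. continuous_on {t\<in>time_dom T. 0 < t} (\<lambda>t. N t \<omega>)"
  shows "AE \<omega> in M.
           ((\<lambda>t. N t \<omega> / integral {0..t} (\<lambda>s. (b s)\<^sup>2 / (\<sigma> s)\<^sup>2 * (X s \<omega>)\<^sup>2))
              \<longlongrightarrow> \<alpha>) (time_limit T)"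
proof -
  obtain b' where b': "\<And>t. t \<in> time_dom T \<Longrightarrow> (b has_real_derivative b' t) (at t within time_dom T)"
    using assms(2) by (auto simp: C1_on_def)
  obtain \<sigma>' where \<sigma>': "continuous_on (time_dom T) \<sigma>'"
    "\<And>t. t \<in> time_dom T \<Longrightarrow> (\<sigma> has_real_derivative \<sigma>' t) (at t within time_dom T)"
    using assms(3) by (auto simp: C1_on_def)
  have b_cont: "continuous_on (time_dom T) b" and \<sigma>_cont: "continuous_on (time_dom T) \<sigma>"
    by (rule DERIV_continuous_on[OF b'], simp, rule DERIV_continuous_on[OF \<sigma>'(2)], simp)
  have \<sigma>_pos: "0 < \<sigma> t" if "t \<in> time_dom T" for t using assms(5) that by blast
  define S where "S t = (LINT s:{s\<in>time_dom T. t \<le> s}|lborel. (\<sigma> s)\<^sup>2)" for t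
  define g where "g t = b t / (\<sigma> t)\<^sup>2" for t
  define g' where "g' t = - 2 * K * (g t * \<sigma> t)\<^sup>2" for t
  have \<sigma>2_cont: "continuous_on (time_dom T) (\<lambda>s. (\<sigma> s)\<^sup>2)" by (intro continuous_intros \<sigma>_cont)
  have S_eq: "S t = S 0 - integral {0..t} (\<lambda>s. (\<sigma> s)\<^sup>2)" if "t \<in> time_dom T" for t
    using tail_integral(1)[OF assms(1) \<sigma>2_cont assms(7) that] by (simp add: S_def)
  have S_small: "\<exists>s\<in>time_dom T. S s < \<epsilon>" if "0 < \<epsilon>" for \<epsilon>
    using tail_integral(2)[OF assms(1) \<sigma>2_cont assms(7) that] by (simp add: S_def)
  have b_S: "b t = (\<sigma> t)\<^sup>2 / (- 2 * K * S t)" if "t \<in> time_dom T" for t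
    using assms(9) that by (simp add: S_def)
  have S_pos: "0 < S t" if t: "t \<in> time_dom T" for t
  proof -
    \<comment> \<open>If \<open>S t\<close> were 0, the convention \<open>x / 0 = 0\<close> would
      give \<open>b t = 0\<close>, which is excluded.\<close>
    have "S t \<noteq> 0" using b_S[OF t] assms(4) t by auto
    moreover have "0 \<le> S t"
      unfolding S_def set_lebesgue_integral_def by (intro integral_nonneg_AE AE_I2) (simp add: indicator_def)
    ultimately show ?thesis by simp
  qed
  have S_deriv: "(S has_real_derivative - (\<sigma> t)\<^sup>2) (at t within time_dom T)" if t: "t \<in> time_dom T" for t
  proof (rule has_field_derivative_transform_within[OF _ zero_less_one t])
    show "((\<lambda>t. S 0 - integral {0..t} (\<lambda>s. (\<sigma> s)\<^sup>2)) has_real_derivative - (\<sigma> t)\<^sup>2) (at t within time_dom T)"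
      by (auto intro!: derivative_eq_intros has_real_derivative_integral_time_dom[OF \<sigma>2_cont t])
  qed (simp add: S_eq[symmetric])
  have g_eq: "g t = - 1 / (2 * K * S t)" if t: "t \<in> time_dom T" for t
    using \<sigma>_pos[OF t] S_pos[OF t] assms(8) unfolding g_def b_S[OF t] by (simp add: field_simps)
  have g_deriv: "(g has_real_derivative g' t) (at t within time_dom T)" if t: "t \<in> time_dom T" for t
  proof (rule has_field_derivative_transform_within[OF _ zero_less_one t])
    show "((\<lambda>t. - 1 / (2 * K * S t)) has_real_derivative g' t) (at t within time_dom T)"
      using S_pos[OF t] assms(8)
      by (auto intro!: derivative_eq_intros S_deriv[OF t] simp: g'_def g_eq[OF t] power2_eq_square field_simps)
  qed (simp add: g_eq)
  have g_cont: "continuous_on (time_dom T) g"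
    by (rule DERIV_continuous_on[OF g_deriv])
  have g'_cont: "continuous_on (time_dom T) g'"
    unfolding g'_def by (intro continuous_intros g_cont \<sigma>_cont)
  have b_eq: "b t = g t * (\<sigma> t)\<^sup>2" if t: "t \<in> time_dom T" for t
    using \<sigma>_pos[OF t] by (simp add: g_def)
  interpret bridge_sde M T \<alpha> b \<sigma> \<sigma>' g g' B X N K S
    by unfold_locales
       (use assms b_cont \<sigma>' g'_cont g_deriv b_eq S_pos S_deriv S_small g_eq
         in \<open>auto simp: g_def[symmetric] g'_def\<close>)
  have energy_eq: "energy t \<omega> = integral {0..t} (\<lambda>s. (b s)\<^sup>2 / (\<sigma> s)\<^sup>2 * (X s \<omega>)\<^sup>2)" if "ereal t < T" for t \<omega>
    unfolding energy_def
  proof (rule integral_cong)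
    fix s assume "s \<in> {0..t}"
    then have "0 < \<sigma> s" using interval_subset_time_dom[OF that] by (intro \<sigma>_pos) blast
    then show "(g s * \<sigma> s * X s \<omega>)\<^sup>2 = (b s)\<^sup>2 / (\<sigma> s)\<^sup>2 * (X s \<omega>)\<^sup>2"
      by (simp add: g_def power2_eq_square)
  qed
  \<comment> \<open>The two denominators have been identified for times before \<open>T\<close>, and
    that is where the limit filter eventually lives.\<close>
  have "\<forall>\<^sub>F t in time_limit T. N t \<omega> / energy t \<omega>
      = N t \<omega> / integral {0..t} (\<lambda>s. (b s)\<^sup>2 / (\<sigma> s)\<^sup>2 * (X s \<omega>)\<^sup>2)" for \<omega>
    using eventually_time_limit[OF zero_mem] by eventually_elim (simp add: energy_eq)
  from Lim_transform_eventually[OF _ this] AE_estimator_tendsto show ?thesis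
    by (auto elim: AE_mp)
qed

end
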